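(* Let $P:A\to A$ be a real positive contractive map (resp. projection) on a Jordan operator algebra $A$ (possibly with no kind of approximate identity). There exists a largest approximately unital Jordan subalgebra $D$ of $A$, and it is a hereditary subalgebra of $A$. Moreover, $P(D)\subset D$, and the restriction $P'$ of $P$ to $D$ is a real positive contractive map (resp. projection) on $D$. In addition, $P'$ is bicontractive (resp. symmetric) if $P$ has the same property.
   Context: Scalars are complex and all maps are linear. A Jordan operator algebra is a norm-closed subspace $A$ of $B(H)$, $H$ a complex Hilbert space, with $a^2\in A$ for all $a\in A$ (equivalently, closed under $a\circ b=\frac12(ab+ba)$); Jordan subalgebras here are norm closed. It is approximately unital if it has a Jordan contractive approximate identity (Jordan cai): a net $(e_t)$ of contractions with $e_t\circ a\to a$ in norm for all $a$. An element $a$ is real positive if $a+a^*\ge0$; a map is real positive if it takes real positive elements to real positive elements. A projection on $A$ is an idempotent linear map. A contractive map $P$ is bicontractive if $\|I-P\|\le1$, and symmetric if $\|I-2P\|\le1$. A hereditary subalgebra of $A$ is a Jordan subalgebra $D$ possessing a Jordan cai with $aAa\subset D$ for all $a\in D$. *)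

theory Defs
  imports "HOL-Analysis.Analysis"
begin

section \<open>Complex Hilbert spaces\<close>

class complex_vector = real_vector +
  fixes scaleC :: "complex \<Rightarrow> 'a \<Rightarrow> 'a" (infixr \<open>*\<^sub>C\<close> 75)
  assumes scaleC_add_right: "c *\<^sub>C (x + y) = c *\<^sub>C x + c *\<^sub>C y"
    and scaleC_add_left: "(c + d) *\<^sub>C x = c *\<^sub>C x + d *\<^sub>C x"
    and scaleC_scaleC: "c *\<^sub>C d *\<^sub>C x = (c * d) *\<^sub>C x"
    and scaleC_of_real: "complex_of_real r *\<^sub>C x = r *\<^sub>R x"

text \<open>
  The inner product is linear in the first argument. Its real part is the inner product of
  \<^class>\<open>real_inner\<close>, so positive definiteness and the norm
  (\<^prop>\<open>norm x = sqrt (inner x x)\<close>) are inherited from there.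
\<close>

class complex_inner = real_inner + complex_vector +
  fixes cinner :: "'a \<Rightarrow> 'a \<Rightarrow> complex"
  assumes cinner_commute: "cinner x y = cnj (cinner y x)"
    and cinner_add_left: "cinner (x + y) z = cinner x z + cinner y z"
    and cinner_scaleC_left: "cinner (c *\<^sub>C x) y = c * cinner x y"
    and Re_cinner: "Re (cinner x y) = inner x y"

class complex_hilbert_space = complex_inner + complete_space

instantiation complex :: complex_hilbert_space
begin

definition scaleC_complex :: "complex \<Rightarrow> complex \<Rightarrow> complex"
  where "scaleC_complex c x = c * x"

definition cinner_complex :: "complex \<Rightarrow> complex \<Rightarrow> complex"
  where "cinner_complex x y = x * cnj y"

instance
  by standard
    (simp_all add: scaleC_complex_def cinner_complex_def algebra_simps scaleR_conv_of_real
      inner_complex_def)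

end

lemma cinner_self: "cinner x x = complex_of_real ((norm (x::'h::complex_inner))\<^sup>2)"
proof (rule complex_eqI)
  show "Re (cinner x x) = Re (complex_of_real ((norm x)\<^sup>2))"
    by (simp add: Re_cinner power2_norm_eq_inner)
  have "Im (cinner x x) = - Im (cinner x x)"
    using arg_cong[OF cinner_commute[of x x], of Im] by simp
  then show "Im (cinner x x) = Im (complex_of_real ((norm x)\<^sup>2))"
    by simp
qed

lemma Im_cinner: "Im (cinner x y) = - inner (\<i> *\<^sub>C x) (y::'h::complex_inner)"
  unfolding Re_cinner[symmetric] by (simp add: cinner_scaleC_left)

lemma cinner_scaleC_right: "cinner x (c *\<^sub>C y) = cnj c * cinner x (y::'h::complex_inner)"
  unfolding cinner_commute[of x] by (simp add: cinner_scaleC_left)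

lemma norm_scaleC: "norm (c *\<^sub>C (x::'h::complex_inner)) = cmod c * norm x"
proof -
  have "cinner (c *\<^sub>C x) (c *\<^sub>C x) = (c * cnj c) * cinner x x"
    by (simp add: cinner_scaleC_left cinner_scaleC_right)
  then have "complex_of_real ((norm (c *\<^sub>C x))\<^sup>2) = complex_of_real ((cmod c * norm x)\<^sup>2)"
    unfolding cinner_self complex_norm_square[symmetric] by (simp add: power_mult_distrib)
  then have "(norm (c *\<^sub>C x))\<^sup>2 = (cmod c * norm x)\<^sup>2"
    unfolding of_real_eq_iff .
  then show ?thesis
    by (rule power2_eq_imp_eq) simp_all
qed


section \<open>Bounded operators\<close>

text \<open>
  \<open>'h \<Rightarrow>\<^sub>L 'h\<close> consists of the bounded real-linear maps, with the operator norm; \<open>B(H)\<close> is the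
  set of complex-linear ones.
\<close>

definition bounded_ops :: "('h::complex_inner \<Rightarrow>\<^sub>L 'h) set"
  where "bounded_ops = {T. \<forall>c x. blinfun_apply T (c *\<^sub>C x) = c *\<^sub>C blinfun_apply T x}"

definition scaleC_op :: "complex \<Rightarrow> ('h::complex_inner \<Rightarrow>\<^sub>L 'h) \<Rightarrow> ('h \<Rightarrow>\<^sub>L 'h)"
  where "scaleC_op c T = Blinfun (\<lambda>x. c *\<^sub>C blinfun_apply T x)"

lemma blinfun_apply_scaleC_op:
  "blinfun_apply (scaleC_op c T) x = c *\<^sub>C blinfun_apply T (x::'h::complex_inner)"
proof -
  have "bounded_linear (\<lambda>x. c *\<^sub>C blinfun_apply T x)"
  proof (rule bounded_linear_intro)
    show "c *\<^sub>C blinfun_apply T (x + y) = c *\<^sub>C blinfun_apply T x + c *\<^sub>C blinfun_apply T y" for x y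
      by (simp add: blinfun.add_right scaleC_add_right)
    show "c *\<^sub>C blinfun_apply T (r *\<^sub>R x) = r *\<^sub>R c *\<^sub>C blinfun_apply T x" for r x
      by (simp only: blinfun.scaleR_right, simp only: scaleC_of_real[symmetric] scaleC_scaleC
          mult.commute)
    show "norm (c *\<^sub>C blinfun_apply T x) \<le> norm x * (cmod c * norm T)" for x
      using mult_left_mono[OF norm_blinfun[of T x], of "cmod c"]
      by (simp add: norm_scaleC mult_ac)
  qed
  then show ?thesis
    by (simp add: scaleC_op_def bounded_linear_Blinfun_apply)
qed

definition adj :: "('h::complex_hilbert_space \<Rightarrow>\<^sub>L 'h) \<Rightarrow> ('h \<Rightarrow>\<^sub>L 'h)"
  where "adj T = (THE S. \<forall>x y. cinner (blinfun_apply T x) y = cinner x (blinfun_apply S y))"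

definition positive_op :: "('h::complex_inner \<Rightarrow>\<^sub>L 'h) \<Rightarrow> bool"
  where "positive_op T \<longleftrightarrow>
    (\<forall>x. cinner (blinfun_apply T x) x \<in> \<real> \<and> 0 \<le> Re (cinner (blinfun_apply T x) x))"

definition real_positive :: "('h::complex_hilbert_space \<Rightarrow>\<^sub>L 'h) \<Rightarrow> bool"
  where "real_positive a \<longleftrightarrow> positive_op (a + adj a)"


subsection \<open>Existence of adjoints\<close>

lemma riesz_representation:
  fixes f :: "'h::{real_inner, complete_space} \<Rightarrow> real"
  assumes "bounded_linear f"
  obtains y where "\<And>x. f x = inner x y"
proof -
  interpret f: bounded_linear f by fact
  define g where "g x = (inner x x) / 2 - f x" for x
  obtain K where K: "\<And>x. norm (f x) \<le> norm x * K"
    using f.bounded by blast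
  have bdd: "bdd_below (range g)"
  proof (rule bdd_belowI2)
    fix x :: 'h
    have "0 \<le> (norm x - K)\<^sup>2" by simp
    then show "- K\<^sup>2 / 2 \<le> g x"
      using K[of x] by (auto simp: g_def power2_eq_square algebra_simps simp flip: power2_norm_eq_inner)
  qed
  define m where "m = Inf (range g)"
  have m_le: "m \<le> g x" for x
    unfolding m_def using bdd by (simp add: cInf_lower)
  have "\<exists>x. g x < m + 1 / real (Suc n)" for n
  proof -
    have "Inf (range g) < m + 1 / real (Suc n)" by (simp add: m_def)
    then show ?thesis using bdd by (subst (asm) cInf_less_iff) auto
  qed
  then obtain X where X: "\<And>n. g (X n) < m + 1 / real (Suc n)" by metis
  have par: "(norm (x - y))\<^sup>2 \<le> 4 * (g x - m) + 4 * (g y - m)" for x y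
  proof -
    have "g ((1/2) *\<^sub>R (x + y)) = (g x + g y) / 2 - (norm (x - y))\<^sup>2 / 8"
      by (simp add: g_def power2_norm_eq_inner inner_diff_left inner_diff_right inner_add_left
          inner_add_right f.add f.scaleR inner_commute field_simps)
    with m_le[of "(1/2) *\<^sub>R (x + y)"] show ?thesis by argo
  qed
  have "Cauchy X"
  proof (rule metric_CauchyI)
    fix e :: real assume e: "0 < e"
    then obtain N where N: "1 / real (Suc N) < e\<^sup>2 / 8"
      using nat_approx_posE[of "e\<^sup>2 / 8"] by auto
    have "dist (X i) (X j) < e" if "i \<ge> N" "j \<ge> N" for i j
    proof -
      have "g (X k) - m < e\<^sup>2 / 8" if "k \<ge> N" for k
      proof -
        have "1 / real (Suc k) \<le> 1 / real (Suc N)"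
          using that by (intro divide_left_mono) auto
        then show ?thesis using X[of k] N by linarith
      qed
      from this[OF that(1)] this[OF that(2)] par[of "X i" "X j"]
      have "(norm (X i - X j))\<^sup>2 < e\<^sup>2" by argo
      then show ?thesis
        using e by (simp add: dist_norm power2_less_imp_less)
    qed
    then show "\<exists>M. \<forall>i\<ge>M. \<forall>j\<ge>M. dist (X i) (X j) < e" by blast
  qed
  then obtain y where y: "X \<longlonglongrightarrow> y"
    using Cauchy_convergent convergent_def by blast
  have "(\<lambda>n. g (X n)) \<longlonglongrightarrow> g y"
    unfolding g_def by (intro tendsto_intros y f.tendsto) auto
  moreover have "(\<lambda>n. m + 1 / real (Suc n)) \<longlonglongrightarrow> m + 0"
    using LIMSEQ_inverse_real_of_nat
    by (intro tendsto_intros) (simp add: inverse_eq_divide)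
  ultimately have gy: "g y \<le> m"
    using X by (intro LIMSEQ_le[of "\<lambda>n. g (X n)"]) (auto intro: less_imp_le)
  have "f x = inner x y" for x
  proof (rule ccontr)
    assume ne: "f x \<noteq> inner x y"
    define d where "d = inner x y - f x"
    have q: "0 \<le> t * d + t\<^sup>2 * inner x x / 2" for t
    proof -
      have "g (y + t *\<^sub>R x) = g y + t * d + t\<^sup>2 * inner x x / 2"
        by (simp add: g_def d_def inner_add_left inner_add_right f.add f.scaleR inner_commute
            power2_eq_square algebra_simps add_divide_distrib)
      with m_le[of "y + t *\<^sub>R x"] gy show ?thesis by argo
    qed
    have "x \<noteq> 0" using ne by (auto simp: f.zero)
    then have p: "inner x x > 0" by simp
    have "d \<noteq> 0" using ne by (simp add: d_def)
    have "(- d / inner x x) * d + (- d / inner x x)\<^sup>2 * inner x x / 2 = - (d\<^sup>2 / inner x x) / 2"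
      using p by (simp add: power2_eq_square field_simps)
    with q[of "- d / inner x x"] have "0 \<le> - (d\<^sup>2 / inner x x) / 2" by metis
    then have "d\<^sup>2 / inner x x \<le> 0"
      unfolding minus_divide_left[symmetric] by argo
    moreover have "d\<^sup>2 / inner x x > 0"
      using p \<open>d \<noteq> 0\<close> by simp
    ultimately show False by linarith
  qed
  then show ?thesis using that by blast
qed

lemma cinner_adj:
  fixes T :: "'h::complex_hilbert_space \<Rightarrow>\<^sub>L 'h"
  assumes T: "T \<in> bounded_ops"
  shows "cinner (blinfun_apply T x) y = cinner x (blinfun_apply (adj T) y)"
proof -
  have "\<exists>z. \<forall>x. inner (blinfun_apply T x) y = inner x z" for y
  proof -
    have "bounded_linear (\<lambda>x. inner (blinfun_apply T x) y)"
      by (intro bounded_linear_intros)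
    then show ?thesis using riesz_representation by metis
  qed
  then obtain S where S: "\<And>x y. inner (blinfun_apply T x) y = inner x (S y)" by metis
  have "bounded_linear S"
  proof (rule bounded_linear_intro)
    show "S (y + z) = S y + S z" for y z
      by (rule iffD1[OF vector_eq_ldot]) (simp add: inner_add_right flip: S)
    show "S (r *\<^sub>R y) = r *\<^sub>R S y" for r y
      by (rule iffD1[OF vector_eq_ldot]) (simp flip: S)
    show "norm (S y) \<le> norm y * norm T" for y
    proof (cases "S y = 0")
      case False
      have "norm (S y) * norm (S y) = inner (blinfun_apply T (S y)) y"
        unfolding S by (metis power2_eq_square power2_norm_eq_inner)
      also have "\<dots> \<le> norm (blinfun_apply T (S y)) * norm y"
        by (rule norm_cauchy_schwarz)
      also have "\<dots> \<le> (norm T * norm (S y)) * norm y"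
        by (intro mult_right_mono norm_blinfun) auto
      finally show ?thesis using False by (simp add: mult.commute mult.left_commute)
    qed simp
  qed
  then have app: "blinfun_apply (Blinfun S) = S"
    by (rule bounded_linear_Blinfun_apply)
  have ex: "cinner (blinfun_apply T x) y = cinner x (blinfun_apply (Blinfun S) y)" for x y
  proof (rule complex_eqI)
    show "Re (cinner (blinfun_apply T x) y) = Re (cinner x (blinfun_apply (Blinfun S) y))"
      by (simp add: Re_cinner S app)
    have "\<i> *\<^sub>C blinfun_apply T x = blinfun_apply T (\<i> *\<^sub>C x)"
      using T by (simp add: bounded_ops_def)
    then show "Im (cinner (blinfun_apply T x) y) = Im (cinner x (blinfun_apply (Blinfun S) y))"
      by (simp add: Im_cinner S app)
  qed
  have "\<forall>x y. cinner (blinfun_apply T x) y = cinner x (blinfun_apply (adj T) y)"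
    unfolding adj_def
  proof (rule theI[where a = "Blinfun S"])
    fix R :: "'h \<Rightarrow>\<^sub>L 'h"
    assume "\<forall>x y. cinner (blinfun_apply T x) y = cinner x (blinfun_apply R y)"
    then have "inner x (blinfun_apply R y) = inner x (blinfun_apply (Blinfun S) y)" for x y
      unfolding Re_cinner[symmetric] ex[symmetric] by simp
    then show "R = Blinfun S"
      by (intro blinfun_eqI) (rule iffD1[OF vector_eq_ldot], blast)
  qed (use ex in blast)
  then show ?thesis by blast
qed


section \<open>Jordan operator algebras\<close>

definition jordan_prod :: "('h::complex_inner \<Rightarrow>\<^sub>L 'h) \<Rightarrow> ('h \<Rightarrow>\<^sub>L 'h) \<Rightarrow> ('h \<Rightarrow>\<^sub>L 'h)"
  where "jordan_prod a b = (1/2) *\<^sub>R ((a o\<^sub>L b) + (b o\<^sub>L a))"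

definition jordan_operator_algebra :: "('h::complex_inner \<Rightarrow>\<^sub>L 'h) set \<Rightarrow> bool"
  where "jordan_operator_algebra A \<longleftrightarrow>
    A \<subseteq> bounded_ops \<and> 0 \<in> A \<and> (\<forall>a\<in>A. \<forall>b\<in>A. a + b \<in> A) \<and> (\<forall>c. \<forall>a\<in>A. scaleC_op c a \<in> A) \<and>
    closed A \<and> (\<forall>a\<in>A. a o\<^sub>L a \<in> A)"

definition jordan_subalgebra ::
    "('h::complex_inner \<Rightarrow>\<^sub>L 'h) set \<Rightarrow> ('h \<Rightarrow>\<^sub>L 'h) set \<Rightarrow> bool"
  where "jordan_subalgebra D A \<longleftrightarrow> D \<subseteq> A \<and> jordan_operator_algebra D"

text \<open>
  A net is rendered as a function on an index type together with a proper filter of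
  ``eventual'' index sets. The choice of the index type in \<open>approximately_unital\<close> is
  immaterial, and the notion agrees with the one for nets indexed by directed sets; see
  \<open>jordan_cai_imp_approximately_unital\<close>, \<open>net_imp_approximately_unital\<close> and
  \<open>approximately_unital_imp_net\<close> below.
\<close>

definition jordan_cai ::
    "('h::complex_inner \<Rightarrow>\<^sub>L 'h) set \<Rightarrow> ('i \<Rightarrow> ('h \<Rightarrow>\<^sub>L 'h)) \<Rightarrow> 'i filter \<Rightarrow> bool"
  where "jordan_cai A e F \<longleftrightarrow>
    F \<noteq> bot \<and> (\<forall>\<^sub>F t in F. e t \<in> A \<and> norm (e t) \<le> 1) \<and>
    (\<forall>a\<in>A. ((\<lambda>t. jordan_prod (e t) a) \<longlongrightarrow> a) F)"

definition approximately_unital :: "('h::complex_inner \<Rightarrow>\<^sub>L 'h) set \<Rightarrow> bool"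
  where "approximately_unital A \<longleftrightarrow>
    (\<exists>(e :: ('h \<Rightarrow>\<^sub>L 'h) \<Rightarrow> ('h \<Rightarrow>\<^sub>L 'h)) F. jordan_cai A e F)"

lemma jordan_cai_imp_approximately_unital:
  assumes "jordan_cai A e F"
  shows "approximately_unital A"
proof -
  have "jordan_cai A (\<lambda>x. x) (filtermap e F)"
    using assms by (simp add: jordan_cai_def filtermap_bot_iff eventually_filtermap filterlim_filtermap)
  then show ?thesis
    unfolding approximately_unital_def by blast
qed

lemma net_imp_approximately_unital:
  fixes I :: "'i set" and le :: "'i \<Rightarrow> 'i \<Rightarrow> bool"
  assumes "I \<noteq> {}"
    and refl: "\<And>s. s \<in> I \<Longrightarrow> le s s"
    and trans: "\<And>s t u. \<lbrakk>s \<in> I; t \<in> I; u \<in> I; le s t; le t u\<rbrakk> \<Longrightarrow> le s u"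
    and directed: "\<And>s t. \<lbrakk>s \<in> I; t \<in> I\<rbrakk> \<Longrightarrow> \<exists>u\<in>I. le s u \<and> le t u"
    and e: "\<And>t. t \<in> I \<Longrightarrow> e t \<in> A \<and> norm (e t) \<le> 1"
    and lim: "\<And>a \<epsilon>. \<lbrakk>a \<in> A; \<epsilon> > 0\<rbrakk> \<Longrightarrow>
      \<exists>s\<in>I. \<forall>t\<in>I. le s t \<longrightarrow> norm (jordan_prod (e t) a - a) < \<epsilon>"
  shows "approximately_unital A"
proof -
  define F where "F = (INF s\<in>I. principal {t \<in> I. le s t})"
  have ev: "eventually Q F \<longleftrightarrow> (\<exists>s\<in>I. \<forall>t\<in>I. le s t \<longrightarrow> Q t)" for Q
  proof -
    have "eventually Q F \<longleftrightarrow> (\<exists>s\<in>I. eventually Q (principal {t \<in> I. le s t}))"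
      unfolding F_def
    proof (rule eventually_INF_base)
      fix s t assume st: "s \<in> I" "t \<in> I"
      then obtain u where "u \<in> I" "le s u" "le t u" using directed by blast
      then have "{v \<in> I. le u v} \<subseteq> {v \<in> I. le s v} \<inter> {v \<in> I. le t v}"
        using st trans by blast
      then show "\<exists>u\<in>I. principal {v \<in> I. le u v} \<le>
          inf (principal {v \<in> I. le s v}) (principal {v \<in> I. le t v})"
        using \<open>u \<in> I\<close> by (auto simp: inf_principal)
    qed fact
    then show ?thesis by (auto simp: eventually_principal)
  qed
  have "jordan_cai A e F"
    unfolding jordan_cai_def
  proof (intro conjI ballI)
    show "F \<noteq> bot"
      unfolding trivial_limit_def ev using refl by blast
    show "\<forall>\<^sub>F t in F. e t \<in> A \<and> norm (e t) \<le> 1"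
      unfolding ev using e \<open>I \<noteq> {}\<close> by blast
    show "((\<lambda>t. jordan_prod (e t) a) \<longlongrightarrow> a) F" if "a \<in> A" for a
      unfolding tendsto_iff dist_norm ev using lim[OF that] by blast
  qed
  then show ?thesis by (rule jordan_cai_imp_approximately_unital)
qed

lemma approximately_unital_imp_net:
  fixes A :: "('h::complex_inner \<Rightarrow>\<^sub>L 'h) set"
  assumes "approximately_unital A"
  defines "I \<equiv> {S. finite S \<and> S \<subseteq> A} \<times> (UNIV :: nat set)"
    and "le \<equiv> (\<lambda>s t. fst s \<subseteq> fst t \<and> snd s \<le> snd t)"
  obtains e where "\<And>t. t \<in> I \<Longrightarrow> e t \<in> A \<and> norm (e t) \<le> 1"
    and "\<And>a \<epsilon>. \<lbrakk>a \<in> A; \<epsilon> > 0\<rbrakk> \<Longrightarrow>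
      \<exists>s\<in>I. \<forall>t\<in>I. le s t \<longrightarrow> norm (jordan_prod (e t) a - a) < \<epsilon>"
proof -
  obtain f :: "('h \<Rightarrow>\<^sub>L 'h) \<Rightarrow> ('h \<Rightarrow>\<^sub>L 'h)" and F where f: "jordan_cai A f F"
    using assms(1) unfolding approximately_unital_def by blast
  have "\<exists>b. b \<in> A \<and> norm b \<le> 1 \<and> (\<forall>a\<in>fst t. norm (jordan_prod b a - a) < 1 / real (Suc (snd t)))"
    if "t \<in> I" for t
  proof -
    have "finite (fst t)" "fst t \<subseteq> A" using that by (auto simp: I_def)
    have "\<forall>\<^sub>F u in F. \<forall>a\<in>fst t. dist (jordan_prod (f u) a) a < 1 / real (Suc (snd t))"
      using \<open>finite (fst t)\<close>
    proof (rule eventually_ball_finite, intro ballI)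
      fix a assume "a \<in> fst t"
      then have "((\<lambda>u. jordan_prod (f u) a) \<longlongrightarrow> a) F"
        using f \<open>fst t \<subseteq> A\<close> by (auto simp: jordan_cai_def)
      then show "\<forall>\<^sub>F u in F. dist (jordan_prod (f u) a) a < 1 / real (Suc (snd t))"
        by (rule tendstoD) simp
    qed
    moreover have "\<forall>\<^sub>F u in F. f u \<in> A \<and> norm (f u) \<le> 1"
      using f by (simp add: jordan_cai_def)
    ultimately have "\<forall>\<^sub>F u in F. (f u \<in> A \<and> norm (f u) \<le> 1) \<and>
        (\<forall>a\<in>fst t. dist (jordan_prod (f u) a) a < 1 / real (Suc (snd t)))"
      by (rule eventually_conj[rotated])
    moreover have "F \<noteq> bot" using f by (simp add: jordan_cai_def)
    ultimately show ?thesis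
      unfolding dist_norm by (blast dest: eventually_happens')
  qed
  then obtain e where e: "\<And>t. t \<in> I \<Longrightarrow> e t \<in> A \<and> norm (e t) \<le> 1 \<and>
      (\<forall>a\<in>fst t. norm (jordan_prod (e t) a - a) < 1 / real (Suc (snd t)))"
    by metis
  show ?thesis
  proof (rule that)
    show "e t \<in> A \<and> norm (e t) \<le> 1" if "t \<in> I" for t
      using e[OF that] by blast
    fix a and \<epsilon> :: real assume "a \<in> A" "\<epsilon> > 0"
    then obtain n where n: "1 / real (Suc n) < \<epsilon>" using nat_approx_posE by blast
    have "norm (jordan_prod (e t) a - a) < \<epsilon>" if "t \<in> I" "le ({a}, n) t" for t
    proof -
      have "norm (jordan_prod (e t) a - a) < 1 / real (Suc (snd t))"
        using e[OF that(1)] that(2) by (simp add: le_def)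
      also have "\<dots> \<le> 1 / real (Suc n)"
        using that(2) by (intro divide_left_mono) (auto simp: le_def)
      finally show ?thesis using n by linarith
    qed
    moreover have "({a}, n) \<in> I" using \<open>a \<in> A\<close> by (simp add: I_def)
    ultimately show "\<exists>s\<in>I. \<forall>t\<in>I. le s t \<longrightarrow> norm (jordan_prod (e t) a - a) < \<epsilon>"
      by blast
  qed
qed

definition hereditary_subalgebra ::
    "('h::complex_inner \<Rightarrow>\<^sub>L 'h) set \<Rightarrow> ('h \<Rightarrow>\<^sub>L 'h) set \<Rightarrow> bool"
  where "hereditary_subalgebra D A \<longleftrightarrow>
    jordan_subalgebra D A \<and> approximately_unital D \<and> (\<forall>a\<in>D. \<forall>x\<in>A. a o\<^sub>L x o\<^sub>L a \<in> D)"

definition largest_approximately_unital_subalgebra ::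
    "('h::complex_inner \<Rightarrow>\<^sub>L 'h) set \<Rightarrow> ('h \<Rightarrow>\<^sub>L 'h) set \<Rightarrow> bool"
  where "largest_approximately_unital_subalgebra D A \<longleftrightarrow>
    jordan_subalgebra D A \<and> approximately_unital D \<and>
    (\<forall>E. jordan_subalgebra E A \<and> approximately_unital E \<longrightarrow> E \<subseteq> D)"


section \<open>Maps on a Jordan operator algebra\<close>

text \<open>
  Maps \<open>A \<rightarrow> A\<close> are functions on the ambient type; the predicates below depend only on their
  values on \<open>A\<close>.
\<close>

definition linear_map_on ::
    "('h::complex_inner \<Rightarrow>\<^sub>L 'h) set \<Rightarrow> (('h \<Rightarrow>\<^sub>L 'h) \<Rightarrow> ('h \<Rightarrow>\<^sub>L 'h)) \<Rightarrow> bool"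
  where "linear_map_on A P \<longleftrightarrow>
    P \<in> A \<rightarrow> A \<and> (\<forall>a\<in>A. \<forall>b\<in>A. P (a + b) = P a + P b) \<and>
    (\<forall>c. \<forall>a\<in>A. P (scaleC_op c a) = scaleC_op c (P a))"

definition real_positive_map_on ::
    "('h::complex_hilbert_space \<Rightarrow>\<^sub>L 'h) set \<Rightarrow> (('h \<Rightarrow>\<^sub>L 'h) \<Rightarrow> ('h \<Rightarrow>\<^sub>L 'h)) \<Rightarrow> bool"
  where "real_positive_map_on A P \<longleftrightarrow> (\<forall>a\<in>A. real_positive a \<longrightarrow> real_positive (P a))"

definition contractive_on ::
    "('h::complex_inner \<Rightarrow>\<^sub>L 'h) set \<Rightarrow> (('h \<Rightarrow>\<^sub>L 'h) \<Rightarrow> ('h \<Rightarrow>\<^sub>L 'h)) \<Rightarrow> bool"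
  where "contractive_on A P \<longleftrightarrow> (\<forall>a\<in>A. norm (P a) \<le> norm a)"

definition projection_on ::
    "('h::complex_inner \<Rightarrow>\<^sub>L 'h) set \<Rightarrow> (('h \<Rightarrow>\<^sub>L 'h) \<Rightarrow> ('h \<Rightarrow>\<^sub>L 'h)) \<Rightarrow> bool"
  where "projection_on A P \<longleftrightarrow> linear_map_on A P \<and> (\<forall>a\<in>A. P (P a) = P a)"

definition bicontractive_on ::
    "('h::complex_inner \<Rightarrow>\<^sub>L 'h) set \<Rightarrow> (('h \<Rightarrow>\<^sub>L 'h) \<Rightarrow> ('h \<Rightarrow>\<^sub>L 'h)) \<Rightarrow> bool"
  where "bicontractive_on A P \<longleftrightarrow> contractive_on A P \<and> contractive_on A (\<lambda>a. a - P a)"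

definition symmetric_on ::
    "('h::complex_inner \<Rightarrow>\<^sub>L 'h) set \<Rightarrow> (('h \<Rightarrow>\<^sub>L 'h) \<Rightarrow> ('h \<Rightarrow>\<^sub>L 'h)) \<Rightarrow> bool"
  where "symmetric_on A P \<longleftrightarrow> contractive_on A P \<and> contractive_on A (\<lambda>a. a - 2 *\<^sub>R P a)"

end

theory Submission
  imports Defs
begin

text \<open>
  Call \<open>e\<close> firmly nonexpansive if \<open>\<parallel>e h\<parallel>\<^sup>2 \<le> Re \<langle>e h, h\<rangle>\<close> for all \<open>h\<close>, equivalently
  \<open>\<parallel>I - 2e\<parallel> \<le> 1\<close>. The largest approximately unital Jordan subalgebra \<open>D\<close> of \<open>A\<close> consists of
  the elements that have arbitrarily good two-sided approximate units among the firmly nonexpansive elements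
  of \<open>A\<close>.

  The firmly nonexpansive elements of \<open>A\<close> are directed: the Yosida approximants
  \<open>t z (1 + t z)\<^sup>-\<^sup>1\<close> of \<open>z = (e + f)/2\<close> are firmly nonexpansive elements of \<open>A\<close> and, as \<open>t\<close> tends to infinity,
  approximate units for both \<open>e\<close> and \<open>f\<close> (\<open>dominating_approximant\<close>). Therefore \<open>D\<close> is a closed
  subspace; it contains the firmly nonexpansive elements themselves, which provide a contractive approximate identity,
  and \<open>a x a\<close> has the approximate units of \<open>a\<close>, so that \<open>D\<close> is a hereditary subalgebra.

  Real positive elements lie in \<open>D\<close>, because they are limits of multiples of their Yosida approximants as \<open>t\<close>
  tends to zero (\<open>accretive_in_support_part\<close>). Conversely \<open>D\<close> is the closed real span of the real positive
  elements of \<open>A\<close>: an element \<open>a\<close> of \<open>D\<close> is a limit of sandwiches \<open>e a e\<close>, and \<open>e + \<delta> e a e\<close> is real positive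
  for small \<open>\<delta>\<close> (\<open>accretive_add_sandwich\<close>). So every bounded linear map on \<open>A\<close> that preserves real positivity maps \<open>D\<close>
  into \<open>D\<close>. All the inequalities asked of the restriction are inherited from \<open>A\<close>.

  The remaining point is that \<open>D\<close> contains every approximately unital Jordan subalgebra \<open>E\<close>. First, a Jordan
  approximate identity of contractions is automatically two-sided (\<open>contraction_defect_bound\<close>). Secondly, any
  \<open>a\<close> in \<open>E\<close> is approximately fixed by a real positive element of \<open>E\<close> (\<open>accretive_approximate_unit\<close>). That element
  is a weighted sum of approximate units chosen one after the other: each
  new one is close to the identity where the previous partial sum is not small, and so cancels part of the
  negative part that is still left.
\<close>

section \<open>Composition of operators\<close>

text \<open>
  The Banach fixed point theorem will be applied to sets of operators, so completeness must pass from
  the Hilbert space to its operator space.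
\<close>

instance complex_hilbert_space \<subseteq> banach ..

lemmas compose_simps =
  bounded_bilinear.add_left[OF bounded_bilinear_blinfun_compose]
  bounded_bilinear.add_right[OF bounded_bilinear_blinfun_compose]
  bounded_bilinear.diff_left[OF bounded_bilinear_blinfun_compose]
  bounded_bilinear.diff_right[OF bounded_bilinear_blinfun_compose]
  bounded_bilinear.scaleR_left[OF bounded_bilinear_blinfun_compose]
  bounded_bilinear.scaleR_right[OF bounded_bilinear_blinfun_compose]

lemma compose_assoc: "(a o\<^sub>L b) o\<^sub>L c = a o\<^sub>L (b o\<^sub>L c)"
  by (rule blinfun_eqI) simp

section \<open>Accretive and firmly nonexpansive operators\<close>

text \<open>
  Only the real part of the inner product enters the notion of real positivity, so the analysis takes
  place in the underlying real Hilbert space.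
\<close>

definition accretive :: "('h::real_inner \<Rightarrow>\<^sub>L 'h) \<Rightarrow> bool"
  where "accretive T \<longleftrightarrow> (\<forall>h. 0 \<le> inner (blinfun_apply T h) h)"

text \<open>
  These are the operators \<open>T\<close> with \<open>\<parallel>I - 2T\<parallel> \<le> 1\<close>, that is, one half of the
  set \<open>{a. \<parallel>I - a\<parallel> \<le> 1}\<close>. The quadratic form of such an operator controls the operator itself,
  which fails for accretive operators in general (a skew-adjoint operator has form \<open>0\<close>).
\<close>

definition firmly_nonexpansive :: "('h::real_inner \<Rightarrow>\<^sub>L 'h) \<Rightarrow> bool"
  where "firmly_nonexpansive T \<longleftrightarrow>
    (\<forall>h. (norm (blinfun_apply T h))\<^sup>2 \<le> inner (blinfun_apply T h) h)"

lemma inner_adj: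
  assumes "T \<in> bounded_ops"
  shows "inner (blinfun_apply T x) y = inner x (blinfun_apply (adj T) y)"
  using arg_cong[OF cinner_adj[OF assms, of x y], of Re] by (simp only: Re_cinner)

lemma real_positive_iff_accretive:
  assumes "T \<in> bounded_ops"
  shows "real_positive T \<longleftrightarrow> accretive T"
proof -
  have "cinner (blinfun_apply (T + adj T) x) x = complex_of_real (2 * inner (blinfun_apply T x) x)" for x
  proof -
    have "cinner (blinfun_apply (adj T) x) x = cnj (cinner (blinfun_apply T x) x)"
      unfolding cinner_adj[OF assms] by (rule cinner_commute)
    then show ?thesis
      by (simp add: blinfun.add_left cinner_add_left complex_add_cnj Re_cinner)
  qed
  then show ?thesis
    by (simp add: real_positive_def positive_op_def accretive_def)
qed

text \<open>
  The adjoint is given as a mere function, so that it can be a composition or difference of adjoints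
  without first being recognised as the \<^const>\<open>adj\<close> of an operator.
\<close>

lemma norm_formal_adjoint_le:
  fixes T :: "'h::real_inner \<Rightarrow>\<^sub>L 'h"
  assumes adj: "\<And>x y. inner (blinfun_apply T x) y = inner x (S y)"
  shows "norm (S y) \<le> norm T * norm y"
proof (cases "S y = 0")
  case False
  have "norm (S y) * norm (S y) = inner (blinfun_apply T (S y)) y"
    by (simp add: adj power2_norm_eq_inner flip: power2_eq_square)
  also have "\<dots> \<le> norm (blinfun_apply T (S y)) * norm y"
    by (rule norm_cauchy_schwarz)
  also have "\<dots> \<le> (norm T * norm (S y)) * norm y"
    by (intro mult_right_mono norm_blinfun) auto
  finally show ?thesis using False by (simp add: mult_ac)
qed simp

lemma norm_adj_apply_le:
  assumes "T \<in> bounded_ops"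
  shows "norm (blinfun_apply (adj T) y) \<le> norm T * norm y"
  by (rule norm_formal_adjoint_le) (rule inner_adj[OF assms])

lemma norm_le_of_formal_adjoint:
  fixes T :: "'h::real_inner \<Rightarrow>\<^sub>L 'h"
  assumes "0 \<le> c" and adj: "\<And>h k. inner (blinfun_apply T h) k = inner h (S k)"
    and S: "\<And>k. norm (S k) \<le> c * norm k"
  shows "norm T \<le> c"
proof (rule norm_blinfun_bound[OF \<open>0 \<le> c\<close>])
  fix h
  let ?z = "blinfun_apply T h"
  show "norm ?z \<le> c * norm h"
  proof (cases "?z = 0")
    case False
    have "norm ?z * norm ?z = inner h (S ?z)"
      by (simp add: adj[symmetric] power2_norm_eq_inner flip: power2_eq_square)
    also have "\<dots> \<le> norm h * (c * norm ?z)"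
      using norm_cauchy_schwarz[of h "S ?z"] mult_left_mono[OF S[of ?z], of "norm h"] by simp
    finally show ?thesis using False by (simp add: mult_ac)
  qed (use assms(1) in simp)
qed

lemma firmly_nonexpansive_imp_accretive: "firmly_nonexpansive T \<Longrightarrow> accretive T"
  unfolding firmly_nonexpansive_def accretive_def
  by (blast intro: order_trans[OF zero_le_power2])

lemma firmly_nonexpansive_norm_le:
  assumes "firmly_nonexpansive T"
  shows "norm T \<le> 1"
proof (rule norm_blinfun_bound)
  fix h
  let ?z = "blinfun_apply T h"
  show "norm ?z \<le> 1 * norm h"
  proof (cases "?z = 0")
    case False
    have "norm ?z * norm ?z \<le> norm ?z * norm h"
      using assms norm_cauchy_schwarz[of ?z h]
      by (auto simp: firmly_nonexpansive_def power2_eq_square intro: order_trans)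
    then show ?thesis using False by simp
  qed simp
qed simp

lemma firmly_nonexpansive_iff_reflection:
  "firmly_nonexpansive T \<longleftrightarrow> (\<forall>h. norm (h - 2 *\<^sub>R blinfun_apply T h) \<le> norm h)"
proof -
  have "norm (h - 2 *\<^sub>R blinfun_apply T h) \<le> norm h \<longleftrightarrow>
      (norm (blinfun_apply T h))\<^sup>2 \<le> inner (blinfun_apply T h) h" for h
  proof -
    have "(norm (h - 2 *\<^sub>R blinfun_apply T h))\<^sup>2 =
        (norm h)\<^sup>2 - 4 * inner (blinfun_apply T h) h + 4 * (norm (blinfun_apply T h))\<^sup>2"
      by (simp add: power2_norm_eq_inner algebra_simps inner_commute)
    moreover have "norm (h - 2 *\<^sub>R blinfun_apply T h) \<le> norm h \<longleftrightarrow>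
        (norm (h - 2 *\<^sub>R blinfun_apply T h))\<^sup>2 \<le> (norm h)\<^sup>2"
      by simp
    ultimately show ?thesis by linarith
  qed
  then show ?thesis by (simp add: firmly_nonexpansive_def)
qed

lemma firmly_nonexpansive_adj:
  fixes T :: "'h::complex_hilbert_space \<Rightarrow>\<^sub>L 'h"
  assumes T: "T \<in> bounded_ops" "firmly_nonexpansive T"
  shows "firmly_nonexpansive (adj T)"
  unfolding firmly_nonexpansive_iff_reflection
proof
  fix h
  let ?w = "h - 2 *\<^sub>R blinfun_apply (adj T) h"
  show "norm ?w \<le> norm h"
  proof (cases "?w = 0")
    case False
    have "norm ?w * norm ?w = inner ?w ?w"
      by (simp add: power2_norm_eq_inner flip: power2_eq_square)
    also have "\<dots> = inner (?w - 2 *\<^sub>R blinfun_apply T ?w) h"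
      unfolding inner_diff_left inner_scaleR_left inner_adj[OF T(1)]
      by (simp add: inner_diff_right inner_diff_left)
    also have "\<dots> \<le> norm (?w - 2 *\<^sub>R blinfun_apply T ?w) * norm h"
      by (rule norm_cauchy_schwarz)
    also have "\<dots> \<le> norm ?w * norm h"
      using T(2) by (intro mult_right_mono) (auto simp: firmly_nonexpansive_iff_reflection)
    finally show ?thesis using False by simp
  qed (simp del: right_minus_eq)
qed

text \<open>
  The equation says \<open>g = t x (1 + t x)\<^sup>-\<^sup>1\<close>, the Yosida approximant of \<open>x\<close>. In terms of the resolvent
  vector \<open>h - g h\<close> it reads \<open>g h = t x (h - g h)\<close>, so accretivity of \<open>x\<close> at that vector is exactly the
  claimed inequality at \<open>h\<close>.
\<close>

lemma firmly_nonexpansive_yosida: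
  assumes x: "accretive x" and "0 \<le> t" and g: "g + t *\<^sub>R (x o\<^sub>L g) = t *\<^sub>R x"
  shows "firmly_nonexpansive g"
  unfolding firmly_nonexpansive_def
proof
  fix h
  let ?y = "blinfun_apply g h"
  have "?y + t *\<^sub>R blinfun_apply x ?y = t *\<^sub>R blinfun_apply x h"
    using arg_cong[OF g, of "\<lambda>T. blinfun_apply T h"] by (simp add: blinfun.bilinear_simps)
  then have y: "?y = t *\<^sub>R blinfun_apply x (h - ?y)"
    by (simp add: blinfun.bilinear_simps algebra_simps)
  have "0 \<le> t * inner (blinfun_apply x (h - ?y)) (h - ?y)"
    using x \<open>0 \<le> t\<close> by (simp add: accretive_def)
  also have "\<dots> = inner ?y (h - ?y)"
    by (subst (3) y) simp
  finally show "(norm ?y)\<^sup>2 \<le> inner ?y h"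
    by (simp add: power2_norm_eq_inner inner_diff_right)
qed

text \<open>
  If the form of \<open>z\<close> dominates \<open>\<bar>x\<bar>\<^sup>2\<close>, the Yosida approximants \<open>g\<close> of \<open>z\<close> are right approximate
  units for \<open>x\<close> as well: on \<open>h - g h\<close> the form of \<open>z\<close> has size \<open>O(1/t)\<close>. This is the
  norm version of \<open>ker z \<subseteq> ker x\<close>.
\<close>

lemma norm_defect_right_le:
  fixes x z g :: "'h::real_inner \<Rightarrow>\<^sub>L 'h"
  assumes "0 \<le> C" "0 < t" and x: "\<And>h. (norm (blinfun_apply x h))\<^sup>2 \<le> C * inner (blinfun_apply z h) h"
    and g: "\<And>h. blinfun_apply z h - blinfun_apply z (blinfun_apply g h) = (1 / t) *\<^sub>R blinfun_apply g h"
    and g1: "\<And>h. norm (blinfun_apply g h) \<le> norm h"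
  shows "norm (blinfun_apply x h - blinfun_apply x (blinfun_apply g h)) \<le> sqrt (2 * C / t) * norm h"
proof -
  let ?y = "blinfun_apply g h"
  have "inner ?y (h - ?y) \<le> norm ?y * norm (h - ?y)"
    by (rule norm_cauchy_schwarz)
  also have "\<dots> \<le> norm h * (2 * norm h)"
    using norm_triangle_ineq4[of h ?y] g1[of h] by (intro mult_mono) auto
  finally have y: "inner ?y (h - ?y) \<le> 2 * (norm h)\<^sup>2"
    by (simp add: power2_eq_square)
  have "(norm (blinfun_apply x h - blinfun_apply x ?y))\<^sup>2 \<le> C * inner (blinfun_apply z (h - ?y)) (h - ?y)"
    using x[of "h - ?y"] unfolding blinfun.diff_right .
  also have "\<dots> = (C / t) * inner ?y (h - ?y)"
    unfolding blinfun.diff_right g inner_scaleR_left by simp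
  also have "\<dots> \<le> (C / t) * (2 * (norm h)\<^sup>2)"
    by (intro mult_left_mono y) (use \<open>0 \<le> C\<close> \<open>0 < t\<close> in simp)
  also have "\<dots> = (sqrt (2 * C / t) * norm h)\<^sup>2"
    using \<open>0 \<le> C\<close> \<open>0 < t\<close> by (simp add: power_mult_distrib)
  finally show ?thesis
    by (rule power2_le_imp_le) (use \<open>0 \<le> C\<close> \<open>0 < t\<close> in simp)
qed

text \<open>
  The previous estimate, applied to the adjoints, controls multiplication by \<open>g\<close> from the left.
\<close>

lemma norm_defect_left_le:
  fixes x z g :: "'h::complex_hilbert_space \<Rightarrow>\<^sub>L 'h"
  assumes ops: "x \<in> bounded_ops" "z \<in> bounded_ops" "g \<in> bounded_ops"
    and "0 \<le> C" "0 < t"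
    and x: "\<And>h. (norm (blinfun_apply (adj x) h))\<^sup>2 \<le> C * inner (blinfun_apply z h) h"
    and g: "z - (g o\<^sub>L z) = (1 / t) *\<^sub>R g" and g1: "norm g \<le> 1"
  shows "norm (x - (g o\<^sub>L x)) \<le> sqrt (2 * C / t)"
proof (rule norm_le_of_formal_adjoint)
  let ?S = "\<lambda>k. blinfun_apply (adj x) k - blinfun_apply (adj x) (blinfun_apply (adj g) k)"
  show "inner (blinfun_apply (x - (g o\<^sub>L x)) h) k = inner h (?S k)" for h k
    by (simp add: blinfun.diff_left inner_diff_left inner_diff_right inner_adj[OF ops(1)] inner_adj[OF ops(3)])
  show "norm (?S k) \<le> sqrt (2 * C / t) * norm k" for k
  proof (rule norm_defect_right_le[OF \<open>0 \<le> C\<close> \<open>0 < t\<close>])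
    fix h
    show "(norm (blinfun_apply (adj x) h))\<^sup>2 \<le> C * inner (blinfun_apply (adj z) h) h"
      using x[of h] unfolding inner_adj[OF ops(2)] inner_commute[of h] .
    show "norm (blinfun_apply (adj g) h) \<le> norm h"
      using norm_adj_apply_le[OF ops(3), of h] mult_right_mono[OF g1, of "norm h"] by simp
    have "inner k (blinfun_apply (adj z) h - blinfun_apply (adj z) (blinfun_apply (adj g) h)) =
        inner k ((1 / t) *\<^sub>R blinfun_apply (adj g) h)" for k
    proof -
      have "inner (blinfun_apply (z - (g o\<^sub>L z)) k) h = inner (blinfun_apply ((1 / t) *\<^sub>R g) k) h"
        by (simp only: g)
      then show ?thesis
        by (simp add: blinfun.bilinear_simps inner_diff_left inner_diff_right inner_adj[OF ops(2)] inner_adj[OF ops(3)])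
    qed
    then show "blinfun_apply (adj z) h - blinfun_apply (adj z) (blinfun_apply (adj g) h) = (1 / t) *\<^sub>R blinfun_apply (adj g) h"
      by (rule iffD1[OF vector_eq_ldot, OF allI])
  qed
qed (use \<open>0 \<le> C\<close> \<open>0 < t\<close> in simp)

section \<open>Yosida approximants in a Jordan operator algebra\<close>

lemma scaleC_op_of_real: "scaleC_op (complex_of_real r) (a :: 'h::complex_inner \<Rightarrow>\<^sub>L 'h) = r *\<^sub>R a"
  by (rule blinfun_eqI) (simp add: blinfun_apply_scaleC_op scaleC_of_real blinfun.scaleR_left)

locale jordan_algebra =
  fixes A :: "('h::complex_hilbert_space \<Rightarrow>\<^sub>L 'h) set"
  assumes jordan: "jordan_operator_algebra A"
begin

lemma bounded_opsI: "a \<in> A \<Longrightarrow> a \<in> bounded_ops"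
  and zero_mem: "0 \<in> A"
  and add_mem: "a \<in> A \<Longrightarrow> b \<in> A \<Longrightarrow> a + b \<in> A"
  and scaleC_mem: "a \<in> A \<Longrightarrow> scaleC_op c a \<in> A"
  and closed_carrier: "closed A"
  and square_mem: "a \<in> A \<Longrightarrow> a o\<^sub>L a \<in> A"
  using jordan unfolding jordan_operator_algebra_def by auto

lemma scaleR_mem: "a \<in> A \<Longrightarrow> r *\<^sub>R a \<in> A"
  using scaleC_mem[of a "complex_of_real r"] by (simp add: scaleC_op_of_real)

lemma diff_mem: "a \<in> A \<Longrightarrow> b \<in> A \<Longrightarrow> a - b \<in> A"
  using add_mem[of a "(-1) *\<^sub>R b"] scaleR_mem[of b "-1"] by simp

lemma jordan_prod_mem:
  assumes "a \<in> A" "b \<in> A"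
  shows "jordan_prod a b \<in> A"
proof -
  have "jordan_prod a b = (1/2) *\<^sub>R (((a + b) o\<^sub>L (a + b)) - (a o\<^sub>L a) - (b o\<^sub>L b))"
    by (simp add: jordan_prod_def compose_simps)
  then show ?thesis
    using assms by (auto intro!: scaleR_mem diff_mem square_mem add_mem)
qed

lemma triple_mem:
  assumes "a \<in> A" "x \<in> A"
  shows "a o\<^sub>L x o\<^sub>L a \<in> A"
proof -
  have "a o\<^sub>L x o\<^sub>L a = 2 *\<^sub>R jordan_prod (jordan_prod a x) a - jordan_prod (a o\<^sub>L a) x"
  proof (rule blinfun_eqI)
    fix h
    define p q r where "p = blinfun_apply (a o\<^sub>L x o\<^sub>L a) h" and "q = blinfun_apply (a o\<^sub>L a o\<^sub>L x) h"
      and "r = blinfun_apply (x o\<^sub>L a o\<^sub>L a) h"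
    have "p = 2 *\<^sub>R (1/2) *\<^sub>R ((1/2) *\<^sub>R (p + r) + (1/2) *\<^sub>R (q + p)) - (1/2) *\<^sub>R (q + r)"
      by (simp add: scaleR_add_right flip: scaleR_add_left)
    then show "blinfun_apply (a o\<^sub>L x o\<^sub>L a) h = blinfun_apply (2 *\<^sub>R jordan_prod (jordan_prod a x) a - jordan_prod (a o\<^sub>L a) x) h"
      by (simp add: p_def q_def r_def jordan_prod_def blinfun.bilinear_simps)
  qed
  then show ?thesis
    using assms by (auto intro!: scaleR_mem diff_mem square_mem jordan_prod_mem)
qed

lemma commuting_compose_mem:
  assumes "x \<in> A" "y \<in> A" "x o\<^sub>L y = y o\<^sub>L x"
  shows "x o\<^sub>L y \<in> A"
proof -
  have "jordan_prod x y = x o\<^sub>L y"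
    using assms(3) by (simp add: jordan_prod_def flip: scaleR_2)
  then show ?thesis using jordan_prod_mem assms by metis
qed

text \<open>
  Both existence results for Yosida approximants are instances of this equation. Iterating inside the
  commutant of \<open>x\<close> keeps the fixed point in \<open>A\<close>: a Jordan algebra contains the ordinary product of two
  elements that commute.
\<close>

lemma affine_fixpoint:
  assumes x: "x \<in> A" and "c < 1"
    and c: "\<And>h. norm (\<beta> *\<^sub>R h + \<gamma> *\<^sub>R blinfun_apply x h) \<le> c * norm h"
  shows "\<exists>y\<in>A. x o\<^sub>L y = y o\<^sub>L x \<and> y = \<alpha> *\<^sub>R x + \<beta> *\<^sub>R y + \<gamma> *\<^sub>R (x o\<^sub>L y)"
proof -
  define S where "S = {y \<in> A. x o\<^sub>L y = y o\<^sub>L x}"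
  define f where "f y = \<alpha> *\<^sub>R x + \<beta> *\<^sub>R y + \<gamma> *\<^sub>R (x o\<^sub>L y)" for y
  have "closed {y. x o\<^sub>L y = y o\<^sub>L x}"
    by (intro closed_Collect_eq continuous_intros
        bounded_linear.continuous_on bounded_bilinear.bounded_linear_left
        bounded_bilinear.bounded_linear_right bounded_bilinear_blinfun_compose)
  then have "closed S"
    unfolding S_def using closed_carrier by (simp add: closed_Int Collect_conj_eq flip: Int_def)
  have "\<exists>!y\<in>S. f y = y"
  proof (rule Banach_fix[where c = "max c 0"])
    show "complete S" using \<open>closed S\<close> by (simp add: complete_eq_closed)
    show "S \<noteq> {}" using zero_mem by (auto simp: S_def bounded_bilinear.zero_right[OF bounded_bilinear_blinfun_compose]
      bounded_bilinear.zero_left[OF bounded_bilinear_blinfun_compose])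
    show "f ` S \<subseteq> S"
    proof
      fix w assume "w \<in> f ` S"
      then obtain y where y: "y \<in> A" "x o\<^sub>L y = y o\<^sub>L x" "w = f y" by (auto simp: S_def)
      then have "w \<in> A"
        unfolding y(3) f_def by (intro add_mem scaleR_mem commuting_compose_mem x)
      moreover have "x o\<^sub>L w = w o\<^sub>L x"
        unfolding y(3) f_def compose_simps
        by (simp only: y(2)[symmetric] compose_assoc[of x y x])
      ultimately show "w \<in> S" by (simp add: S_def)
    qed
    fix y y'
    show "dist (f y) (f y') \<le> max c 0 * dist y y'"
      unfolding dist_norm
    proof (rule norm_blinfun_bound)
      fix h
      let ?k = "blinfun_apply (y - y') h"
      have "blinfun_apply (f y - f y') h = \<beta> *\<^sub>R ?k + \<gamma> *\<^sub>R blinfun_apply x ?k"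
        by (simp add: f_def blinfun.bilinear_simps algebra_simps)
      then have "norm (blinfun_apply (f y - f y') h) \<le> max c 0 * norm ?k"
        using c[of ?k] mult_right_mono[OF max.cobounded1[of c 0], of "norm ?k"] by simp
      also have "\<dots> \<le> max c 0 * (norm (y - y') * norm h)"
        by (intro mult_left_mono norm_blinfun) auto
      finally show "norm (blinfun_apply (f y - f y') h) \<le> max c 0 * norm (y - y') * norm h"
        by (simp add: mult_ac)
    qed simp
  qed (use \<open>c < 1\<close> in auto)
  then obtain y where y: "y \<in> S" "f y = y" by blast
  show ?thesis
  proof (intro bexI conjI)
    show "y = \<alpha> *\<^sub>R x + \<beta> *\<^sub>R y + \<gamma> *\<^sub>R (x o\<^sub>L y)"
      using y(2)[symmetric] unfolding f_def .
  qed (use y(1) in \<open>auto simp: S_def\<close>)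
qed

text \<open>
  For a general \<open>x\<close> only small \<open>t\<close> are reached; these suffice to approximate \<open>x\<close> itself by \<open>g / t\<close>.
\<close>

lemma yosida_exists_small:
  assumes "x \<in> A" "0 \<le> t" "t * norm x < 1"
  shows "\<exists>g\<in>A. x o\<^sub>L g = g o\<^sub>L x \<and> g + t *\<^sub>R (x o\<^sub>L g) = t *\<^sub>R x"
proof -
  have "norm (0 *\<^sub>R h + (- t) *\<^sub>R blinfun_apply x h) \<le> (t * norm x) * norm h" for h
    using mult_left_mono[OF norm_blinfun[of x h] assms(2)] assms(2) by simp
  from affine_fixpoint[OF assms(1,3) this, of t]
  obtain g where g: "g \<in> A" "x o\<^sub>L g = g o\<^sub>L x" "g = t *\<^sub>R x + 0 *\<^sub>R g + (- t) *\<^sub>R (x o\<^sub>L g)"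
    by blast
  have "g + t *\<^sub>R (x o\<^sub>L g) = t *\<^sub>R x"
    using arg_cong[OF g(3), of "\<lambda>T. T + t *\<^sub>R (x o\<^sub>L g)"] by simp
  with g show ?thesis by blast
qed

text \<open>
  For firmly nonexpansive \<open>x\<close> all \<open>t\<close> are reached, because \<open>1 - 2 x\<close> is a contraction. Large \<open>t\<close> is
  what makes \<open>g\<close> an approximate unit for \<open>x\<close>.
\<close>

lemma yosida_exists:
  assumes x: "x \<in> A" "firmly_nonexpansive x" and t: "0 < t"
  shows "\<exists>g\<in>A. x o\<^sub>L g = g o\<^sub>L x \<and> g + t *\<^sub>R (x o\<^sub>L g) = t *\<^sub>R x"
proof -
  \<comment> \<open>Multiplied by two, the equation is \<open>(2 + t) g = 2 t x + t (1 - 2 x) g\<close>, whose linear part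
    has norm at most \<open>t / (2 + t)\<close>.\<close>
  define b where "b = t / (2 + t)"
  have b: "0 < b" "b < 1" using t by (auto simp: b_def)
  have "norm (b *\<^sub>R h + (- 2 * b) *\<^sub>R blinfun_apply x h) \<le> b * norm h" for h
  proof -
    have "b *\<^sub>R h + (- 2 * b) *\<^sub>R blinfun_apply x h = b *\<^sub>R (h - 2 *\<^sub>R blinfun_apply x h)"
      by (simp add: algebra_simps)
    then show ?thesis
      using x(2) b by (simp add: firmly_nonexpansive_iff_reflection)
  qed
  from affine_fixpoint[OF x(1) b(2) this, of "2 * b"]
  obtain g where g: "g \<in> A" "x o\<^sub>L g = g o\<^sub>L x"
    "g = (2 * b) *\<^sub>R x + b *\<^sub>R g + (- 2 * b) *\<^sub>R (x o\<^sub>L g)" by blast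
  have "(1 - b) *\<^sub>R g + (2 * b) *\<^sub>R (x o\<^sub>L g) = (2 * b) *\<^sub>R x"
    using arg_cong[OF g(3), of "\<lambda>T. T - b *\<^sub>R g + (2 * b) *\<^sub>R (x o\<^sub>L g)"]
    by (simp add: scaleR_diff_left)
  then have "((2 + t) / 2) *\<^sub>R ((1 - b) *\<^sub>R g + (2 * b) *\<^sub>R (x o\<^sub>L g)) = ((2 + t) / 2) *\<^sub>R (2 * b) *\<^sub>R x"
    by simp
  moreover have "(2 + t) / 2 * (1 - b) = 1" "(2 + t) / 2 * (2 * b) = t"
    using t by (auto simp: b_def field_simps)
  ultimately have "g + t *\<^sub>R (x o\<^sub>L g) = t *\<^sub>R x"
    unfolding scaleR_add_right scaleR_scaleR by simp
  with g show ?thesis by blast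
qed

end

section \<open>The part of the algebra supported by firmly nonexpansive elements\<close>

text \<open>
  Being an approximate unit is transitive: if \<open>g\<close> nearly fixes \<open>e\<close> and \<open>e\<close> nearly fixes \<open>b\<close>, then \<open>g\<close>
  nearly fixes \<open>b\<close>. The intermediate \<open>e\<close> will be a firmly nonexpansive or merely an accretive element.
\<close>

lemma norm_approx_left_le:
  fixes g e b :: "'h::real_normed_vector \<Rightarrow>\<^sub>L 'h"
  assumes "norm g \<le> 1"
  shows "norm ((g o\<^sub>L b) - b) \<le> 2 * norm ((e o\<^sub>L b) - b) + norm ((g o\<^sub>L e) - e) * norm b"
proof -
  have "(g o\<^sub>L b) - b = (((g o\<^sub>L e) - e) o\<^sub>L b) - (g o\<^sub>L ((e o\<^sub>L b) - b)) + ((e o\<^sub>L b) - b)"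
    by (simp add: compose_simps compose_assoc)
  also have "norm \<dots> \<le> norm (((g o\<^sub>L e) - e) o\<^sub>L b) + norm (g o\<^sub>L ((e o\<^sub>L b) - b)) + norm ((e o\<^sub>L b) - b)"
    by (intro norm_triangle_le add_mono norm_triangle_ineq4 order_refl)
  also have "norm (((g o\<^sub>L e) - e) o\<^sub>L b) \<le> norm ((g o\<^sub>L e) - e) * norm b"
    by (rule norm_blinfun_compose)
  also have "norm (g o\<^sub>L ((e o\<^sub>L b) - b)) \<le> 1 * norm ((e o\<^sub>L b) - b)"
    by (rule order_trans[OF norm_blinfun_compose]) (intro mult_right_mono assms norm_ge_zero)
  finally show ?thesis by simp
qed

lemma norm_approx_right_le:
  fixes g e b :: "'h::real_normed_vector \<Rightarrow>\<^sub>L 'h"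
  assumes "norm g \<le> 1"
  shows "norm ((b o\<^sub>L g) - b) \<le> 2 * norm ((b o\<^sub>L e) - b) + norm ((e o\<^sub>L g) - e) * norm b"
proof -
  have "(b o\<^sub>L g) - b = (b o\<^sub>L ((e o\<^sub>L g) - e)) - (((b o\<^sub>L e) - b) o\<^sub>L g) + ((b o\<^sub>L e) - b)"
    by (simp add: compose_simps compose_assoc)
  also have "norm \<dots> \<le> norm (b o\<^sub>L ((e o\<^sub>L g) - e)) + norm (((b o\<^sub>L e) - b) o\<^sub>L g) + norm ((b o\<^sub>L e) - b)"
    by (intro norm_triangle_le add_mono norm_triangle_ineq4 order_refl)
  also have "norm (b o\<^sub>L ((e o\<^sub>L g) - e)) \<le> norm b * norm ((e o\<^sub>L g) - e)"
    by (rule norm_blinfun_compose)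
  also have "norm (((b o\<^sub>L e) - b) o\<^sub>L g) \<le> norm ((b o\<^sub>L e) - b) * 1"
    by (rule order_trans[OF norm_blinfun_compose]) (intro mult_left_mono assms norm_ge_zero)
  finally show ?thesis by (simp add: mult.commute)
qed

lemma norm_approx_left_perturb:
  fixes e a b :: "'h::real_normed_vector \<Rightarrow>\<^sub>L 'h"
  assumes "norm e \<le> 1"
  shows "norm ((e o\<^sub>L b) - b) \<le> norm ((e o\<^sub>L a) - a) + 2 * norm (a - b)"
proof -
  have "(e o\<^sub>L b) - b = (((e o\<^sub>L a) - a) - (e o\<^sub>L (a - b))) + (a - b)"
    by (simp add: compose_simps)
  also have "norm \<dots> \<le> norm ((e o\<^sub>L a) - a) + norm (e o\<^sub>L (a - b)) + norm (a - b)"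
    by (intro norm_triangle_le add_mono norm_triangle_ineq4 order_refl)
  also have "norm (e o\<^sub>L (a - b)) \<le> 1 * norm (a - b)"
    by (rule order_trans[OF norm_blinfun_compose]) (intro mult_right_mono assms norm_ge_zero)
  finally show ?thesis by simp
qed

lemma norm_approx_right_perturb:
  fixes e a b :: "'h::real_normed_vector \<Rightarrow>\<^sub>L 'h"
  assumes "norm e \<le> 1"
  shows "norm ((b o\<^sub>L e) - b) \<le> norm ((a o\<^sub>L e) - a) + 2 * norm (a - b)"
proof -
  have "(b o\<^sub>L e) - b = (((a o\<^sub>L e) - a) - ((a - b) o\<^sub>L e)) + (a - b)"
    by (simp add: compose_simps)
  also have "norm \<dots> \<le> norm ((a o\<^sub>L e) - a) + norm ((a - b) o\<^sub>L e) + norm (a - b)"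
    by (intro norm_triangle_le add_mono norm_triangle_ineq4 order_refl)
  also have "norm ((a - b) o\<^sub>L e) \<le> norm (a - b) * 1"
    by (rule order_trans[OF norm_blinfun_compose]) (intro mult_left_mono assms norm_ge_zero)
  finally show ?thesis by simp
qed

lemma firmly_nonexpansive_midpoint:
  assumes "firmly_nonexpansive e" "firmly_nonexpansive f"
  shows "firmly_nonexpansive ((1/2) *\<^sub>R (e + f))"
  unfolding firmly_nonexpansive_iff_reflection
proof
  fix h
  have "h - 2 *\<^sub>R blinfun_apply ((1/2) *\<^sub>R (e + f)) h =
      (1/2) *\<^sub>R ((h - 2 *\<^sub>R blinfun_apply e h) + (h - 2 *\<^sub>R blinfun_apply f h))"
    by (simp add: blinfun.bilinear_simps algebra_simps flip: scaleR_add_left)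
  moreover have "norm ((h - 2 *\<^sub>R blinfun_apply e h) + (h - 2 *\<^sub>R blinfun_apply f h)) \<le> norm h + norm h"
    using assms unfolding firmly_nonexpansive_iff_reflection
    by (intro norm_triangle_le add_mono) auto
  ultimately show "norm (h - 2 *\<^sub>R blinfun_apply ((1/2) *\<^sub>R (e + f)) h) \<le> norm h"
    by simp
qed

context jordan_algebra
begin

text \<open>
  Directedness of the firmly nonexpansive elements. The midpoint of \<open>e\<close> and \<open>f\<close> dominates each of them
  as a quadratic form, so its Yosida approximants for large \<open>t\<close> are approximate units for both.
\<close>

lemma dominating_approximant:
  assumes e: "e \<in> A" "firmly_nonexpansive e" and f: "f \<in> A" "firmly_nonexpansive f" and "0 < \<epsilon>"
  shows "\<exists>g\<in>A. firmly_nonexpansive g \<and>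
    (\<forall>x\<in>{e, f}. norm ((g o\<^sub>L x) - x) < \<epsilon> \<and> norm ((x o\<^sub>L g) - x) < \<epsilon>)"
proof -
  define z where "z = (1/2) *\<^sub>R (e + f)"
  define t where "t = 16 / \<epsilon>\<^sup>2"
  have t: "0 < t" and eps: "sqrt (2 * 2 / t) = \<epsilon> / 2"
    using \<open>0 < \<epsilon>\<close> by (auto simp: t_def real_sqrt_divide)
  have z: "z \<in> A" "firmly_nonexpansive z"
    using e f by (auto simp: z_def intro: firmly_nonexpansive_midpoint scaleR_mem add_mem)
  obtain g where g: "g \<in> A" "z o\<^sub>L g = g o\<^sub>L z" "g + t *\<^sub>R (z o\<^sub>L g) = t *\<^sub>R z"
    using yosida_exists[OF z t] by blast
  have fg: "firmly_nonexpansive g"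
    using firmly_nonexpansive_yosida[OF firmly_nonexpansive_imp_accretive[OF z(2)] _ g(3)] t by simp
  have g1: "norm g \<le> 1" by (rule firmly_nonexpansive_norm_le[OF fg])
  have tg: "t *\<^sub>R (z - (z o\<^sub>L g)) = g"
    by (simp add: scaleR_diff_right flip: g(3))
  have "z - (z o\<^sub>L g) = (1 / t) *\<^sub>R t *\<^sub>R (z - (z o\<^sub>L g))"
    using t by simp
  then have zg: "z - (z o\<^sub>L g) = (1 / t) *\<^sub>R g"
    unfolding tg .
  have "norm ((g o\<^sub>L x) - x) < \<epsilon> \<and> norm ((x o\<^sub>L g) - x) < \<epsilon>" if x: "x \<in> {e, f}" for x
  proof -
    have xA: "x \<in> A" and fx: "firmly_nonexpansive x" using x e f by auto
    have dom: "inner (blinfun_apply x h) h \<le> 2 * inner (blinfun_apply z h) h" for h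
    proof -
      have "2 * inner (blinfun_apply z h) h = inner (blinfun_apply e h) h + inner (blinfun_apply f h) h"
        by (simp add: z_def blinfun.bilinear_simps inner_add_left)
      moreover have "0 \<le> inner (blinfun_apply e h) h" "0 \<le> inner (blinfun_apply f h) h"
        using firmly_nonexpansive_imp_accretive e(2) f(2) by (auto simp: accretive_def)
      ultimately show ?thesis using x by auto
    qed
    have "norm (x - (x o\<^sub>L g)) \<le> sqrt (2 * 2 / t)"
    proof (rule norm_blinfun_bound)
      fix h
      have "norm (blinfun_apply x h - blinfun_apply x (blinfun_apply g h)) \<le> sqrt (2 * 2 / t) * norm h"
      proof (rule norm_defect_right_le)
        fix h
        show "(norm (blinfun_apply x h))\<^sup>2 \<le> 2 * inner (blinfun_apply z h) h"
          using fx dom[of h] unfolding firmly_nonexpansive_def by (blast intro: order_trans)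
        show "blinfun_apply z h - blinfun_apply z (blinfun_apply g h) = (1 / t) *\<^sub>R blinfun_apply g h"
          using arg_cong[OF zg, of "\<lambda>T. blinfun_apply T h"] by (simp add: blinfun.bilinear_simps)
        show "norm (blinfun_apply g h) \<le> norm h"
          using norm_blinfun[of g h] mult_right_mono[OF g1, of "norm h"] by simp
      qed (use t in simp_all)
      then show "norm (blinfun_apply (x - (x o\<^sub>L g)) h) \<le> sqrt (2 * 2 / t) * norm h"
        by (simp add: blinfun.diff_left)
    qed (use t in simp)
    moreover have "norm (x - (g o\<^sub>L x)) \<le> sqrt (2 * 2 / t)"
    proof (rule norm_defect_left_le)
      show "(norm (blinfun_apply (adj x) h))\<^sup>2 \<le> 2 * inner (blinfun_apply z h) h" for h
      proof -
        have "(norm (blinfun_apply (adj x) h))\<^sup>2 \<le> inner (blinfun_apply (adj x) h) h"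
          using firmly_nonexpansive_adj[OF bounded_opsI[OF xA] fx] unfolding firmly_nonexpansive_def by blast
        also have "\<dots> = inner (blinfun_apply x h) h"
          unfolding inner_adj[OF bounded_opsI[OF xA]] by (rule inner_commute)
        finally show ?thesis using dom[of h] by linarith
      qed
    qed (use t g1 zg g(2) xA z(1) g(1) bounded_opsI in simp_all)
    ultimately show ?thesis
      using \<open>0 < \<epsilon>\<close> unfolding eps by (simp add: norm_minus_commute)
  qed
  with g(1) fg show ?thesis by blast
qed

text \<open>
  For an associative operator algebra this is the closure of the union of the corners \<open>e A e\<close> over
  the firmly nonexpansive \<open>e\<close>. Describing it by approximate units makes closure under \<open>a x a\<close> immediate,
  and leaves closure under sums to the directedness above.
\<close>

definition support_part :: "('h \<Rightarrow>\<^sub>L 'h) set"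
  where "support_part = {a \<in> A. \<forall>\<epsilon>>0. \<exists>e\<in>A. firmly_nonexpansive e \<and>
    norm ((e o\<^sub>L a) - a) < \<epsilon> \<and> norm ((a o\<^sub>L e) - a) < \<epsilon>}"

lemma support_part_subset: "support_part \<subseteq> A"
  by (auto simp: support_part_def)

lemma support_partI:
  assumes "a \<in> A"
    and "\<And>\<epsilon>. 0 < \<epsilon> \<Longrightarrow> \<exists>e\<in>A. firmly_nonexpansive e \<and> norm ((e o\<^sub>L a) - a) < \<epsilon> \<and> norm ((a o\<^sub>L e) - a) < \<epsilon>"
  shows "a \<in> support_part"
  using assms by (auto simp: support_part_def)

lemma support_partE:
  assumes "a \<in> support_part" "0 < \<epsilon>"
  obtains e where "e \<in> A" "firmly_nonexpansive e" "norm ((e o\<^sub>L a) - a) < \<epsilon>" "norm ((a o\<^sub>L e) - a) < \<epsilon>"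
  using assms by (auto simp: support_part_def)

lemma common_approximant:
  assumes "finite B" "B \<subseteq> support_part" "0 < \<epsilon>"
  shows "\<exists>g\<in>A. firmly_nonexpansive g \<and>
    (\<forall>b\<in>B. norm ((g o\<^sub>L b) - b) < \<epsilon> \<and> norm ((b o\<^sub>L g) - b) < \<epsilon>)"
  using assms
proof (induction B arbitrary: \<epsilon>)
  case empty
  then show ?case by (intro bexI[of _ 0] zero_mem) (auto simp: firmly_nonexpansive_def)
next
  case (insert c B)
  obtain e where e: "e \<in> A" "firmly_nonexpansive e"
    "norm ((e o\<^sub>L c) - c) < \<epsilon> / 4" "norm ((c o\<^sub>L e) - c) < \<epsilon> / 4"
    using insert.prems by (auto elim: support_partE[of c "\<epsilon> / 4"])
  have "0 < \<epsilon> / 4" "B \<subseteq> support_part" using insert.prems by auto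
  from insert.IH[OF this(2,1)]
  obtain f where f: "f \<in> A" "firmly_nonexpansive f"
    "\<And>b. b \<in> B \<Longrightarrow> norm ((f o\<^sub>L b) - b) < \<epsilon> / 4 \<and> norm ((b o\<^sub>L f) - b) < \<epsilon> / 4"
    by blast
  define M where "M = 1 + (\<Sum>b\<in>insert c B. norm b)"
  have M: "0 < M" unfolding M_def by (intro add_pos_nonneg sum_nonneg) auto
  have bM: "norm b \<le> M" if "b \<in> insert c B" for b
  proof -
    have "norm b \<le> (\<Sum>b\<in>insert c B. norm b)"
      using that insert.hyps by (intro member_le_sum) auto
    then show ?thesis by (simp add: M_def)
  qed
  obtain g where g: "g \<in> A" "firmly_nonexpansive g"
    "\<And>x. x \<in> {e, f} \<Longrightarrow> norm ((g o\<^sub>L x) - x) < \<epsilon> / (4 * M) \<and> norm ((x o\<^sub>L g) - x) < \<epsilon> / (4 * M)"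
    using dominating_approximant[OF e(1,2) f(1,2), of "\<epsilon> / (4 * M)"] M insert.prems by auto
  have g1: "norm g \<le> 1" by (rule firmly_nonexpansive_norm_le[OF g(2)])
  have "norm ((g o\<^sub>L b) - b) < \<epsilon> \<and> norm ((b o\<^sub>L g) - b) < \<epsilon>" if b: "b \<in> insert c B" for b
  proof -
    obtain x where x: "x \<in> {e, f}" "norm ((x o\<^sub>L b) - b) < \<epsilon> / 4" "norm ((b o\<^sub>L x) - b) < \<epsilon> / 4"
      using b e f by blast
    have *: "d * norm b \<le> \<epsilon> / 4" if "0 \<le> d" "d < \<epsilon> / (4 * M)" for d
    proof -
      have "d * norm b \<le> (\<epsilon> / (4 * M)) * M"
        using that bM[OF b] M insert.prems by (intro mult_mono) auto
      then show ?thesis using M by simp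
    qed
    show ?thesis
      using norm_approx_left_le[OF g1, of b x] norm_approx_right_le[OF g1, of b x] x(2,3) g(3)[OF x(1)]
        *[of "norm ((g o\<^sub>L x) - x)"] *[of "norm ((x o\<^sub>L g) - x)"]
        insert.prems(2)
      by auto
  qed
  with g(1,2) show ?case by blast
qed

lemma support_part_closed: "closed support_part"
proof -
  have "x \<in> support_part" if x: "x \<in> closure support_part" for x
  proof (rule support_partI)
    show "x \<in> A" using x closure_minimal[OF support_part_subset closed_carrier] by blast
    fix \<epsilon> :: real assume "0 < \<epsilon>"
    then have "0 < \<epsilon> / 3" by simp
    then obtain a where a: "a \<in> support_part" "norm (a - x) < \<epsilon> / 3"
      using x unfolding closure_approachable dist_norm by blast
    obtain e where e: "e \<in> A" "firmly_nonexpansive e" "norm ((e o\<^sub>L a) - a) < \<epsilon> / 3" "norm ((a o\<^sub>L e) - a) < \<epsilon> / 3"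
      using support_partE[OF a(1) \<open>0 < \<epsilon> / 3\<close>] .
    have e1: "norm e \<le> 1" by (rule firmly_nonexpansive_norm_le[OF e(2)])
    show "\<exists>e\<in>A. firmly_nonexpansive e \<and> norm ((e o\<^sub>L x) - x) < \<epsilon> \<and> norm ((x o\<^sub>L e) - x) < \<epsilon>"
      using norm_approx_left_perturb[OF e1, of x a] norm_approx_right_perturb[OF e1, of x a] a(2) e
      by (intro bexI[of _ e]) auto
  qed
  then show ?thesis by (metis closure_subset_eq subsetI)
qed

lemma support_part_add:
  assumes "a \<in> support_part" "b \<in> support_part"
  shows "a + b \<in> support_part"
proof (rule support_partI)
  show "a + b \<in> A" using assms support_part_subset add_mem by blast
  fix \<epsilon> :: real assume "0 < \<epsilon>"
  then obtain g where g: "g \<in> A" "firmly_nonexpansive g"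
    "\<And>x. x \<in> {a, b} \<Longrightarrow> norm ((g o\<^sub>L x) - x) < \<epsilon> / 2 \<and> norm ((x o\<^sub>L g) - x) < \<epsilon> / 2"
    using common_approximant[of "{a, b}" "\<epsilon> / 2"] assms by auto
  have "(g o\<^sub>L (a + b)) - (a + b) = ((g o\<^sub>L a) - a) + ((g o\<^sub>L b) - b)"
    "((a + b) o\<^sub>L g) - (a + b) = ((a o\<^sub>L g) - a) + ((b o\<^sub>L g) - b)"
    by (simp_all add: compose_simps)
  moreover have "norm ((g o\<^sub>L a) - a) + norm ((g o\<^sub>L b) - b) < \<epsilon>"
    "norm ((a o\<^sub>L g) - a) + norm ((b o\<^sub>L g) - b) < \<epsilon>"
    using g(3)[of a] g(3)[of b] by auto
  ultimately have "norm ((g o\<^sub>L (a + b)) - (a + b)) < \<epsilon>" "norm (((a + b) o\<^sub>L g) - (a + b)) < \<epsilon>"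
    by (simp_all only: norm_triangle_lt)
  with g(1,2) show "\<exists>e\<in>A. firmly_nonexpansive e \<and> norm ((e o\<^sub>L (a + b)) - (a + b)) < \<epsilon> \<and>
      norm (((a + b) o\<^sub>L e) - (a + b)) < \<epsilon>" by blast
qed

lemma support_part_scaleC:
  assumes "a \<in> support_part"
  shows "scaleC_op c a \<in> support_part"
proof (rule support_partI)
  show "scaleC_op c a \<in> A" using assms support_part_subset scaleC_mem by blast
  fix \<epsilon> :: real assume "0 < \<epsilon>"
  define M where "M = cmod c + 1"
  have M: "0 < M" "cmod c < M" by (auto simp: M_def add_nonneg_pos)
  have "0 < \<epsilon> / M" using \<open>0 < \<epsilon>\<close> M by simp
  then obtain e where e: "e \<in> A" "firmly_nonexpansive e" "norm ((e o\<^sub>L a) - a) < \<epsilon> / M" "norm ((a o\<^sub>L e) - a) < \<epsilon> / M"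
    using support_partE[OF assms] by blast
  have scale_diff: "c *\<^sub>C (x - y) = c *\<^sub>C x - c *\<^sub>C (y::'h)" for x y
    using scaleC_add_right[of c "x - y" y] by (simp add: algebra_simps)
  have L: "(e o\<^sub>L scaleC_op c a) - scaleC_op c a = scaleC_op c ((e o\<^sub>L a) - a)"
    using bounded_opsI[OF e(1)]
    by (intro blinfun_eqI) (simp add: blinfun_apply_scaleC_op blinfun.diff_left bounded_ops_def scale_diff)
  have R: "(scaleC_op c a o\<^sub>L e) - scaleC_op c a = scaleC_op c ((a o\<^sub>L e) - a)"
    by (intro blinfun_eqI) (simp add: blinfun_apply_scaleC_op blinfun.diff_left scale_diff)
  have N: "norm (scaleC_op c T) < \<epsilon>" if "norm T < \<epsilon> / M" for T :: "'h \<Rightarrow>\<^sub>L 'h"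
  proof -
    have "norm (scaleC_op c T) \<le> cmod c * norm T"
      using mult_left_mono[OF norm_blinfun[of T], of "cmod c"]
      by (intro norm_blinfun_bound) (auto simp: blinfun_apply_scaleC_op norm_scaleC mult_ac)
    also have "\<dots> \<le> M * norm T" using M by (intro mult_right_mono) auto
    also have "\<dots> < \<epsilon>" using that M by (simp add: field_simps)
    finally show ?thesis .
  qed
  show "\<exists>e\<in>A. firmly_nonexpansive e \<and> norm ((e o\<^sub>L scaleC_op c a) - scaleC_op c a) < \<epsilon> \<and>
      norm ((scaleC_op c a o\<^sub>L e) - scaleC_op c a) < \<epsilon>"
    using e(1,2) N[OF e(3)] N[OF e(4)] unfolding L[symmetric] R[symmetric] by blast
qed

text \<open>
  The product \<open>a x b\<close> inherits left approximate units from \<open>a\<close> and right ones from \<open>b\<close>.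
\<close>

lemma support_part_outer:
  assumes a: "a \<in> support_part" and "a o\<^sub>L x o\<^sub>L b \<in> A" and b: "b \<in> support_part"
  shows "a o\<^sub>L x o\<^sub>L b \<in> support_part"
proof (rule support_partI)
  fix \<epsilon> :: real assume "0 < \<epsilon>"
  define M where "M = 1 + norm (x o\<^sub>L b) + norm (a o\<^sub>L x)"
  have M: "0 < M" "norm (x o\<^sub>L b) \<le> M" "norm (a o\<^sub>L x) \<le> M" by (auto simp: M_def add_pos_nonneg)
  then obtain e where e: "e \<in> A" "firmly_nonexpansive e"
    "\<And>y. y \<in> {a, b} \<Longrightarrow> norm ((e o\<^sub>L y) - y) < \<epsilon> / M \<and> norm ((y o\<^sub>L e) - y) < \<epsilon> / M"
    using common_approximant[of "{a, b}" "\<epsilon> / M"] a b \<open>0 < \<epsilon>\<close> by auto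
  have N: "p * q < \<epsilon>" if "0 \<le> p" "p < \<epsilon> / M" "q \<le> M" "0 \<le> q" for p q
  proof -
    have "p * q \<le> p * M" using that by (intro mult_left_mono) auto
    also have "\<dots> < \<epsilon>" using that(2) M(1) by (simp add: field_simps)
    finally show ?thesis .
  qed
  have "(e o\<^sub>L (a o\<^sub>L x o\<^sub>L b)) - (a o\<^sub>L x o\<^sub>L b) = ((e o\<^sub>L a) - a) o\<^sub>L (x o\<^sub>L b)"
    by (simp add: compose_simps compose_assoc)
  then have "norm ((e o\<^sub>L (a o\<^sub>L x o\<^sub>L b)) - (a o\<^sub>L x o\<^sub>L b)) < \<epsilon>"
    using norm_blinfun_compose[of "(e o\<^sub>L a) - a" "x o\<^sub>L b"] N[of "norm ((e o\<^sub>L a) - a)" "norm (x o\<^sub>L b)"] e(3)[of a] M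
    by simp
  moreover have "((a o\<^sub>L x o\<^sub>L b) o\<^sub>L e) - (a o\<^sub>L x o\<^sub>L b) = (a o\<^sub>L x) o\<^sub>L ((b o\<^sub>L e) - b)"
    by (simp add: compose_simps compose_assoc)
  then have "norm (((a o\<^sub>L x o\<^sub>L b) o\<^sub>L e) - (a o\<^sub>L x o\<^sub>L b)) < \<epsilon>"
    using norm_blinfun_compose[of "a o\<^sub>L x" "(b o\<^sub>L e) - b"] N[of "norm ((b o\<^sub>L e) - b)" "norm (a o\<^sub>L x)"] e(3)[of b] M
    by (simp add: mult.commute)
  ultimately show "\<exists>e\<in>A. firmly_nonexpansive e \<and> norm ((e o\<^sub>L (a o\<^sub>L x o\<^sub>L b)) - (a o\<^sub>L x o\<^sub>L b)) < \<epsilon> \<and>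
      norm (((a o\<^sub>L x o\<^sub>L b) o\<^sub>L e) - (a o\<^sub>L x o\<^sub>L b)) < \<epsilon>"
    using e(1,2) by blast
qed (use assms in simp)

lemma firmly_nonexpansive_in_support_part:
  assumes "e \<in> A" "firmly_nonexpansive e"
  shows "e \<in> support_part"
proof (rule support_partI)
  show "\<exists>g\<in>A. firmly_nonexpansive g \<and> norm ((g o\<^sub>L e) - e) < \<epsilon> \<and> norm ((e o\<^sub>L g) - e) < \<epsilon>" if "0 < \<epsilon>" for \<epsilon>
    using dominating_approximant[OF assms assms that] by auto
qed fact

lemma jordan_subalgebra_support_part: "jordan_subalgebra support_part A"
  unfolding jordan_subalgebra_def jordan_operator_algebra_def
proof (intro conjI ballI allI)
  show "0 \<in> support_part"
    by (rule firmly_nonexpansive_in_support_part[OF zero_mem]) (simp add: firmly_nonexpansive_def)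
  show "a o\<^sub>L a \<in> support_part" if a: "a \<in> support_part" for a
  proof -
    have "a o\<^sub>L id_blinfun o\<^sub>L a = a o\<^sub>L a" by (rule blinfun_eqI) simp
    then show ?thesis
      using support_part_outer[OF a _ a, of id_blinfun] square_mem a support_part_subset by auto
  qed
qed (use support_part_subset bounded_opsI support_part_closed support_part_add support_part_scaleC in auto)

lemma approximately_unital_support_part: "approximately_unital support_part"
proof -
  define I where "I = {B. finite B \<and> B \<subseteq> support_part} \<times> (UNIV :: nat set)"
  define le where "le s t \<longleftrightarrow> fst s \<subseteq> fst t \<and> snd s \<le> snd t"
    for s t :: "('h \<Rightarrow>\<^sub>L 'h) set \<times> nat"
  have "\<exists>g. g \<in> A \<and> firmly_nonexpansive g \<and>
      (\<forall>b\<in>fst t. norm ((g o\<^sub>L b) - b) < 1 / real (Suc (snd t)) \<and> norm ((b o\<^sub>L g) - b) < 1 / real (Suc (snd t)))"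
    if "t \<in> I" for t
    using common_approximant[of "fst t" "1 / real (Suc (snd t))"] that by (auto simp: I_def)
  then obtain g where g: "\<And>t. t \<in> I \<Longrightarrow> g t \<in> A \<and> firmly_nonexpansive (g t) \<and>
      (\<forall>b\<in>fst t. norm ((g t o\<^sub>L b) - b) < 1 / real (Suc (snd t)) \<and> norm ((b o\<^sub>L g t) - b) < 1 / real (Suc (snd t)))"
    by metis
  show ?thesis
  proof (rule net_imp_approximately_unital[of I le g])
    show "I \<noteq> {}" by (auto simp: I_def)
    show "le s s" for s by (simp add: le_def)
    show "le s u" if "le s t" "le t u" for s t u using that by (auto simp: le_def)
    show "\<exists>u\<in>I. le s u \<and> le t u" if "s \<in> I" "t \<in> I" for s t
      using that by (intro bexI[of _ "(fst s \<union> fst t, max (snd s) (snd t))"]) (auto simp: I_def le_def)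
    show "g t \<in> support_part \<and> norm (g t) \<le> 1" if "t \<in> I" for t
      using g[OF that] firmly_nonexpansive_in_support_part firmly_nonexpansive_norm_le by blast
    fix a and \<epsilon> :: real assume a: "a \<in> support_part" and "0 < \<epsilon>"
    obtain n where n: "1 / real (Suc n) < \<epsilon>" using nat_approx_posE[OF \<open>0 < \<epsilon>\<close>] .
    have "norm (jordan_prod (g t) a - a) < \<epsilon>" if t: "t \<in> I" "le ({a}, n) t" for t
    proof -
      have "1 / real (Suc (snd t)) \<le> 1 / real (Suc n)"
        using t(2) by (intro divide_left_mono) (auto simp: le_def)
      then have "norm ((g t o\<^sub>L a) - a) < \<epsilon>" "norm ((a o\<^sub>L g t) - a) < \<epsilon>"
        using g[OF t(1)] t(2) n by (force simp: le_def)+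
      then have "norm (((g t o\<^sub>L a) - a) + ((a o\<^sub>L g t) - a)) < 2 * \<epsilon>"
        using norm_triangle_ineq[of "(g t o\<^sub>L a) - a" "(a o\<^sub>L g t) - a"] by linarith
      moreover have "jordan_prod (g t) a - a = (1/2) *\<^sub>R (((g t o\<^sub>L a) - a) + ((a o\<^sub>L g t) - a))"
        by (simp add: jordan_prod_def algebra_simps flip: scaleR_add_left)
      ultimately show ?thesis by simp
    qed
    moreover have "({a}, n) \<in> I" using a by (simp add: I_def)
    ultimately show "\<exists>s\<in>I. \<forall>t\<in>I. le s t \<longrightarrow> norm (jordan_prod (g t) a - a) < \<epsilon>"
      by blast
  qed
qed

lemma hereditary_subalgebra_support_part: "hereditary_subalgebra support_part A"
  unfolding hereditary_subalgebra_def
  using jordan_subalgebra_support_part approximately_unital_support_part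
    support_part_outer triple_mem support_part_subset by blast

text \<open>
  An accretive \<open>x\<close> is the limit, as \<open>t\<close> tends to \<open>0\<close>, of multiples \<open>g / t\<close> of its Yosida
  approximants, which are firmly nonexpansive.
\<close>

lemma accretive_in_support_part:
  assumes x: "x \<in> A" "accretive x"
  shows "x \<in> support_part"
proof -
  have "\<exists>y\<in>support_part. dist y x < \<epsilon>" if "0 < \<epsilon>" for \<epsilon>
  proof -
    define M where "M = norm x + 1"
    define t where "t = min (1 / M) (\<epsilon> / (2 * M\<^sup>2))"
    have M: "0 < M" "norm x < M" by (auto simp: M_def add_nonneg_pos)
    have t: "0 < t" using M that by (simp add: t_def)
    have "t * norm x < t * M" using t M by simp
    also have "\<dots> \<le> (1 / M) * M" using M by (intro mult_right_mono) (auto simp: t_def)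
    finally have "t * norm x < 1" using M by simp
    then obtain g where g: "g \<in> A" "x o\<^sub>L g = g o\<^sub>L x" "g + t *\<^sub>R (x o\<^sub>L g) = t *\<^sub>R x"
      using yosida_exists_small[of x t] x t by auto
    have fg: "firmly_nonexpansive g"
      using firmly_nonexpansive_yosida[OF x(2) _ g(3)] t by simp
    define y where "y = (1 / t) *\<^sub>R g"
    have "y \<in> support_part"
      using support_part_scaleC[OF firmly_nonexpansive_in_support_part[OF g(1) fg], of "complex_of_real (1 / t)"]
      unfolding y_def scaleC_op_of_real .
    moreover have "dist y x < \<epsilon>"
    proof -
      have eq: "g = t *\<^sub>R x - t *\<^sub>R (x o\<^sub>L g)" using g(3) by (metis add_diff_cancel_right')
      have xg: "norm (x o\<^sub>L g) \<le> norm x * norm g" by (rule norm_blinfun_compose)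
      also have "\<dots> \<le> norm x * 1"
        by (intro mult_left_mono firmly_nonexpansive_norm_le[OF fg]) simp
      finally have "norm (x o\<^sub>L g) \<le> norm x" by simp
      then have "norm (t *\<^sub>R x - t *\<^sub>R (x o\<^sub>L g)) \<le> t * norm x + t * norm x"
        using t by (intro order_trans[OF norm_triangle_ineq4] add_mono) (auto intro: mult_left_mono)
      then have ng: "norm g \<le> 2 * t * norm x" using eq by simp
      have "y = x - (x o\<^sub>L g)"
        unfolding y_def by (subst eq) (use t in \<open>simp add: scaleR_diff_right\<close>)
      then have "dist y x = norm (x o\<^sub>L g)" by (simp add: dist_norm)
      also have "\<dots> \<le> norm x * (2 * t * norm x)"
        by (rule order_trans[OF xg]) (intro mult_left_mono ng norm_ge_zero)
      also have "\<dots> = 2 * t * (norm x)\<^sup>2" by (simp add: power2_eq_square)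
      also have "\<dots> < 2 * t * M\<^sup>2" using t M by (simp add: power_strict_mono)
      also have "\<dots> \<le> 2 * (\<epsilon> / (2 * M\<^sup>2)) * M\<^sup>2"
        by (intro mult_right_mono mult_left_mono) (auto simp: t_def)
      also have "\<dots> = \<epsilon>" using M by simp
      finally show ?thesis .
    qed
    ultimately show ?thesis by blast
  qed
  then show ?thesis using closed_approachable[OF support_part_closed] by blast
qed

text \<open>
  The sandwich \<open>e a e\<close> is dominated by \<open>e\<close>: by Cauchy-Schwarz its form is at most
  \<open>\<parallel>a\<parallel> \<parallel>e h\<parallel> \<parallel>e\<^sup>* h\<parallel>\<close>, and both factors are bounded by the square root of the form of \<open>e\<close>.
\<close>

lemma accretive_add_sandwich:
  assumes e: "e \<in> A" "firmly_nonexpansive e" and "a \<in> A" and \<delta>: "0 \<le> \<delta>" "\<delta> * norm a \<le> 1"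
  shows "accretive (e + \<delta> *\<^sub>R (e o\<^sub>L a o\<^sub>L e))"
  unfolding accretive_def
proof
  fix h
  let ?E = "inner (blinfun_apply e h) h" and ?b = "blinfun_apply (adj e) h"
  have eh: "norm (blinfun_apply e h) \<le> sqrt ?E"
    using e(2) by (intro real_le_rsqrt) (simp add: firmly_nonexpansive_def)
  have "(norm ?b)\<^sup>2 \<le> inner ?b h"
    using firmly_nonexpansive_adj[OF bounded_opsI[OF e(1)] e(2)] unfolding firmly_nonexpansive_def by blast
  also have "\<dots> = ?E" unfolding inner_adj[OF bounded_opsI[OF e(1)]] by (rule inner_commute)
  finally have eh': "norm ?b \<le> sqrt ?E" by (rule real_le_rsqrt)
  have E: "0 \<le> ?E" using firmly_nonexpansive_imp_accretive[OF e(2)] by (simp add: accretive_def)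
  have "inner (blinfun_apply (e o\<^sub>L a o\<^sub>L e) h) h = inner (blinfun_apply a (blinfun_apply e h)) ?b"
    by (simp add: inner_adj[OF bounded_opsI[OF e(1)]])
  moreover have "\<bar>inner (blinfun_apply a (blinfun_apply e h)) ?b\<bar> \<le> (norm a * norm (blinfun_apply e h)) * norm ?b"
    using Cauchy_Schwarz_ineq2[of "blinfun_apply a (blinfun_apply e h)" ?b]
      mult_right_mono[OF norm_blinfun[of a "blinfun_apply e h"], of "norm ?b"] by simp
  moreover have "\<dots> \<le> (norm a * sqrt ?E) * sqrt ?E"
    using eh eh' E by (intro mult_mono) auto
  ultimately have "\<bar>inner (blinfun_apply (e o\<^sub>L a o\<^sub>L e) h) h\<bar> \<le> norm a * ?E"
    using E by (simp add: mult.assoc)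
  then have "\<delta> * \<bar>inner (blinfun_apply (e o\<^sub>L a o\<^sub>L e) h) h\<bar> \<le> (\<delta> * norm a) * ?E"
    using \<delta>(1) by (simp add: mult.assoc mult_left_mono)
  also have "\<dots> \<le> 1 * ?E" using \<delta>(2) E by (intro mult_right_mono)
  finally have "\<bar>\<delta> * inner (blinfun_apply (e o\<^sub>L a o\<^sub>L e) h) h\<bar> \<le> ?E"
    using \<delta>(1) by (simp add: abs_mult)
  then show "0 \<le> inner (blinfun_apply (e + \<delta> *\<^sub>R (e o\<^sub>L a o\<^sub>L e)) h) h"
    by (simp add: blinfun.bilinear_simps inner_add_left)
qed

text \<open>
  Elements of the support part are limits of sandwiches \<open>e a e\<close>, and each of these is a multiple of a
  difference of two accretive elements of \<open>A\<close>. A real positive map sends accretive elements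
  to accretive elements, which lie in the support part.
\<close>

lemma image_support_part_subset:
  assumes lin: "linear_map_on A P" and pos: "real_positive_map_on A P" and contr: "contractive_on A P"
  shows "P ` support_part \<subseteq> support_part"
proof
  fix w assume "w \<in> P ` support_part"
  then obtain a where a: "a \<in> support_part" "w = P a" by blast
  then have aA: "a \<in> A" using support_part_subset by blast
  have PA: "P x \<in> A" if "x \<in> A" for x using lin that by (auto simp: linear_map_on_def)
  have Padd: "P (x + y) = P x + P y" if "x \<in> A" "y \<in> A" for x y
    using lin that by (auto simp: linear_map_on_def)
  have Pscale: "P (r *\<^sub>R x) = r *\<^sub>R P x" if "x \<in> A" for x r
    using lin that unfolding linear_map_on_def scaleC_op_of_real[symmetric] by blast
  have Pdiff: "P (x - y) = P x - P y" if "x \<in> A" "y \<in> A" for x y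
    using Padd[of x "(-1) *\<^sub>R y"] Pscale[of y "-1"] scaleR_mem[of y "-1"] that by simp
  have Ppos: "P x \<in> support_part" if "x \<in> A" "accretive x" for x
  proof (rule accretive_in_support_part[OF PA[OF that(1)]])
    have "real_positive (P x)"
      using pos that by (simp add: real_positive_map_on_def real_positive_iff_accretive bounded_opsI)
    then show "accretive (P x)"
      by (simp add: real_positive_iff_accretive bounded_opsI PA[OF that(1)])
  qed
  have scaleR_sp: "r *\<^sub>R x \<in> support_part" if "x \<in> support_part" for r x
    using support_part_scaleC[OF that, of "complex_of_real r"] by (simp add: scaleC_op_of_real)
  have "\<exists>y\<in>support_part. dist y w < \<epsilon>" if "0 < \<epsilon>" for \<epsilon>
  proof -
    have "0 < \<epsilon> / 2" using that by simp
    then obtain e where e: "e \<in> A" "firmly_nonexpansive e" "norm ((e o\<^sub>L a) - a) < \<epsilon> / 2" "norm ((a o\<^sub>L e) - a) < \<epsilon> / 2"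
      using support_partE[OF a(1)] by blast
    define \<delta> where "\<delta> = 1 / (norm a + 1)"
    have \<delta>: "0 < \<delta>" "\<delta> * norm a \<le> 1" by (auto simp: \<delta>_def add_nonneg_pos)
    let ?c = "e o\<^sub>L a o\<^sub>L e"
    have c: "?c \<in> A" by (rule triple_mem[OF e(1) aA])
    have d: "e + \<delta> *\<^sub>R ?c \<in> A" using e(1) c by (intro add_mem scaleR_mem)
    have "P (e + \<delta> *\<^sub>R ?c) \<in> support_part"
      by (rule Ppos[OF d]) (use accretive_add_sandwich[OF e(1,2) aA _ \<delta>(2)] \<delta>(1) in simp)
    moreover have "P e \<in> support_part"
      by (rule Ppos[OF e(1) firmly_nonexpansive_imp_accretive[OF e(2)]])
    ultimately have "(1 / \<delta>) *\<^sub>R (P (e + \<delta> *\<^sub>R ?c) + (-1) *\<^sub>R P e) \<in> support_part"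
      by (intro scaleR_sp support_part_add)
    moreover have "(1 / \<delta>) *\<^sub>R (P (e + \<delta> *\<^sub>R ?c) + (-1) *\<^sub>R P e) = P ?c"
      using \<delta>(1) by (simp add: Padd[OF e(1) scaleR_mem[OF c]] Pscale[OF c])
    ultimately have "P ?c \<in> support_part" by simp
    moreover have "dist (P ?c) w < \<epsilon>"
    proof -
      have "dist (P ?c) w = norm (P (?c - a))"
        by (simp add: dist_norm a(2) Pdiff[OF c aA])
      also have "\<dots> \<le> norm (?c - a)"
        using contr diff_mem[OF c aA] by (simp add: contractive_on_def)
      also have "?c - a = (((e o\<^sub>L a) - a) o\<^sub>L e) + ((a o\<^sub>L e) - a)"
        by (simp add: compose_simps)
      also have "norm \<dots> \<le> norm (((e o\<^sub>L a) - a) o\<^sub>L e) + norm ((a o\<^sub>L e) - a)"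
        by (rule norm_triangle_ineq)
      also have "norm (((e o\<^sub>L a) - a) o\<^sub>L e) \<le> norm ((e o\<^sub>L a) - a) * 1"
        by (rule order_trans[OF norm_blinfun_compose])
          (intro mult_left_mono firmly_nonexpansive_norm_le[OF e(2)] norm_ge_zero)
      finally show ?thesis using e(3,4) by simp
    qed
    ultimately show ?thesis by blast
  qed
  then show "w \<in> support_part" using closed_approachable[OF support_part_closed] by blast
qed

end

section \<open>Jordan approximate identities are two-sided\<close>

text \<open>
  If \<open>e a + a e = 2 a\<close> exactly for a contraction \<open>e\<close>, then \<open>a e\<^sup>k = (2 - e)\<^sup>k a\<close>. The left side stays bounded, whereas
  \<open>2 - e = 1 + d\<close> with \<open>d = 1 - e\<close> accretive gives \<open>\<parallel>(1 + d) v\<parallel>\<^sup>2 \<ge> \<parallel>v\<parallel>\<^sup>2 + \<parallel>d v\<parallel>\<^sup>2\<close>; summing over \<open>n\<close>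
  steps, \<open>n \<parallel>d a h\<parallel>\<^sup>2 \<le> \<parallel>a\<parallel>\<^sup>2 \<parallel>h\<parallel>\<^sup>2\<close>. Hence \<open>e a = a\<close>. The lemma is the
  quantitative form, which tracks an error \<open>\<delta>\<close> through the \<open>n\<close> steps.
\<close>

lemma contraction_defect_bound:
  fixes e a :: "'h::real_inner \<Rightarrow>\<^sub>L 'h"
  assumes e: "norm e \<le> 1" and "norm a \<le> M" and \<delta>: "norm ((e o\<^sub>L a) + (a o\<^sub>L e) - 2 *\<^sub>R a) \<le> 2 * \<delta>"
    and "0 < n"
  shows "(norm ((e o\<^sub>L a) - a))\<^sup>2 \<le> M\<^sup>2 / real n + 28 * real n * \<delta> * M"
proof -
  have M: "0 \<le> M" using norm_ge_zero[of a] \<open>norm a \<le> M\<close> by linarith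
  have \<delta>0: "0 \<le> \<delta>" using order_trans[OF norm_ge_zero \<delta>] by simp
  have e_le: "norm (blinfun_apply e v) \<le> norm v" for v
    using norm_blinfun[of e v] mult_right_mono[OF e, of "norm v"] by simp
  have a_le: "norm (blinfun_apply a v) \<le> M * norm v" for v
    using norm_blinfun[of a v] mult_right_mono[OF \<open>norm a \<le> M\<close>, of "norm v"] by simp
  define d where "d v = v - blinfun_apply e v" for v
  have d_le: "norm (d v) \<le> 2 * norm v" for v
    using norm_triangle_ineq4[of v "blinfun_apply e v"] e_le[of v] by (simp add: d_def)
  have d_add: "d (v + w) = d v + d w" for v w by (simp add: d_def blinfun.add_right)
  have grow: "(norm v)\<^sup>2 + (norm (d v))\<^sup>2 \<le> (norm (v + d v))\<^sup>2" for v
  proof -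
    have "inner (blinfun_apply e v) v \<le> norm (blinfun_apply e v) * norm v" by (rule norm_cauchy_schwarz)
    also have "\<dots> \<le> norm v * norm v" by (intro mult_right_mono e_le norm_ge_zero)
    finally have "0 \<le> inner v (d v)"
      by (simp add: d_def inner_diff_right inner_commute power2_norm_eq_inner flip: power2_eq_square)
    then show ?thesis
      by (simp add: power2_norm_eq_inner inner_add_left inner_add_right inner_commute)
  qed
  have main: "real n * (norm (blinfun_apply ((e o\<^sub>L a) - a) h))\<^sup>2 \<le> (M\<^sup>2 + 28 * (real n)\<^sup>2 * \<delta> * M) * (norm h)\<^sup>2" for h
  proof -
    define N where "N = norm h"
    define x where "x k = ((blinfun_apply e) ^^ k) h" for k
    define v where "v k = blinfun_apply a (x k)" for k
    define r where "r k = v (Suc k) - (v k + d (v k))" for k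
    define D where "D = norm (d (v 0))"
    have x: "norm (x k) \<le> N" for k
    proof (induction k)
      case (Suc k)
      have "norm (x (Suc k)) \<le> norm (x k)" using e_le[of "x k"] by (simp add: x_def)
      with Suc show ?case by linarith
    qed (simp add: x_def N_def)
    have v: "norm (v k) \<le> M * N" for k
      unfolding v_def by (rule order_trans[OF a_le]) (intro mult_left_mono x M)
    have r: "norm (r k) \<le> 2 * \<delta> * N" for k
    proof -
      have "r k = blinfun_apply ((e o\<^sub>L a) + (a o\<^sub>L e) - 2 *\<^sub>R a) (x k)"
        by (simp add: r_def v_def d_def x_def blinfun.bilinear_simps scaleR_2)
      also have "norm \<dots> \<le> (2 * \<delta>) * N"
        by (rule order_trans[OF norm_blinfun]) (use \<delta> x \<delta>0 in \<open>auto intro!: mult_mono\<close>)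
      finally show ?thesis .
    qed
    have v_Suc: "v (Suc k) = (v k + d (v k)) + r k" for k by (simp add: r_def)
    \<comment> \<open>\<open>d\<close> commutes with \<open>1 + d\<close>, so the defects \<open>d (v k)\<close> cannot shrink by more than the errors.\<close>
    have dv: "D - 4 * real k * \<delta> * N \<le> norm (d (v k))" for k
    proof (induction k)
      case (Suc k)
      have "norm (d (v k)) \<le> norm (d (v k) + d (d (v k)))"
        using grow[of "d (v k)"] zero_le_power2[of "norm (d (d (v k)))"]
        by - (rule power2_le_imp_le, linarith, simp)
      also have "\<dots> = norm (d (v (Suc k)) - d (r k))"
        by (simp add: v_Suc d_add)
      also have "\<dots> \<le> norm (d (v (Suc k))) + norm (d (r k))" by (rule norm_triangle_ineq4)
      also have "norm (d (r k)) \<le> 2 * (2 * \<delta> * N)"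
        using d_le[of "r k"] r[of k] by linarith
      finally show ?case using Suc by (simp add: algebra_simps)
    qed (simp add: D_def)
    have D: "0 \<le> D" "D \<le> 2 * M * N"
      using d_le[of "v 0"] v[of 0] by (auto simp: D_def)
    have N: "0 \<le> N" by (simp add: N_def)
    have dv2: "D\<^sup>2 - 16 * real k * \<delta> * M * N\<^sup>2 \<le> (norm (d (v k)))\<^sup>2" for k
    proof -
      define s where "s = 4 * real k * \<delta> * N"
      have s: "0 \<le> s" "D - s \<le> norm (d (v k))" using dv[of k] \<delta>0 N by (auto simp: s_def)
      have "D\<^sup>2 - 2 * D * s \<le> (norm (d (v k)))\<^sup>2"
      proof (cases "s \<le> D")
        case True
        have "D\<^sup>2 - 2 * D * s \<le> (D - s)\<^sup>2" by (simp add: power2_diff)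
        also have "\<dots> \<le> (norm (d (v k)))\<^sup>2" using s True by (intro power_mono) auto
        finally show ?thesis .
      next
        case False
        then have "D * D \<le> D * (2 * s)" using D by (intro mult_left_mono) auto
        then have "D\<^sup>2 - 2 * D * s \<le> 0" by (simp add: power2_eq_square mult_ac)
        then show ?thesis using zero_le_power2 by (rule order_trans)
      qed
      moreover have "2 * D * s \<le> 2 * (2 * M * N) * s"
        using D s by (intro mult_right_mono) auto
      moreover have "2 * (2 * M * N) * s = 16 * real k * \<delta> * M * N\<^sup>2"
        by (simp add: s_def power2_eq_square)
      ultimately show ?thesis by linarith
    qed
    have v_grow: "(norm (v k))\<^sup>2 + (norm (d (v k)))\<^sup>2 \<le> (norm (v (Suc k)))\<^sup>2 + 12 * \<delta> * M * N\<^sup>2" for k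
    proof -
      let ?w = "v k + d (v k)"
      have "norm ?w \<le> 3 * M * N"
        using norm_triangle_ineq[of "v k" "d (v k)"] d_le[of "v k"] v[of k] by linarith
      then have "norm ?w * norm (r k) \<le> (3 * M * N) * (2 * \<delta> * N)"
        using r[of k] M N by (intro mult_mono) auto
      moreover have "- (norm ?w * norm (r k)) \<le> inner ?w (r k)"
        using Cauchy_Schwarz_ineq2[of ?w "r k"] by linarith
      moreover have "(norm (v (Suc k)))\<^sup>2 = (norm ?w)\<^sup>2 + 2 * inner ?w (r k) + (norm (r k))\<^sup>2"
        unfolding v_Suc power2_norm_eq_inner by (simp add: inner_add_left inner_add_right inner_commute)
      moreover have "(3 * M * N) * (2 * \<delta> * N) = 6 * (\<delta> * M * N\<^sup>2)"
        by (simp add: power2_eq_square)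
      ultimately show ?thesis using grow[of "v k"] zero_le_power2[of "norm (r k)"] by linarith
    qed
    have "real k * D\<^sup>2 \<le> (norm (v k))\<^sup>2 + 28 * (real k)\<^sup>2 * (\<delta> * M * N\<^sup>2)" for k
    proof (induction k)
      case (Suc k)
      define c where "c = \<delta> * M * N\<^sup>2"
      have c: "0 \<le> c" "0 \<le> real k * c" using \<delta>0 M by (auto simp: c_def)
      have "28 * (real (Suc k))\<^sup>2 * c = 28 * (real k)\<^sup>2 * c + 56 * (real k * c) + 28 * c"
        by (simp add: power2_eq_square algebra_simps)
      moreover have "real (Suc k) * D\<^sup>2 = real k * D\<^sup>2 + D\<^sup>2" by (simp add: algebra_simps)
      moreover have "D\<^sup>2 - 16 * (real k * c) \<le> (norm (d (v k)))\<^sup>2"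
        "(norm (v k))\<^sup>2 + (norm (d (v k)))\<^sup>2 \<le> (norm (v (Suc k)))\<^sup>2 + 12 * c"
        using dv2[of k] v_grow[of k] by (simp_all add: c_def mult_ac)
      ultimately show ?case using Suc c unfolding c_def[symmetric] by linarith
    qed simp
    from this[of n] have "real n * D\<^sup>2 \<le> (norm (v n))\<^sup>2 + 28 * (real n)\<^sup>2 * (\<delta> * M * N\<^sup>2)" .
    also have "(norm (v n))\<^sup>2 \<le> (M * N)\<^sup>2" using v[of n] by (intro power_mono) auto
    also have "(M * N)\<^sup>2 + 28 * (real n)\<^sup>2 * (\<delta> * M * N\<^sup>2) = (M\<^sup>2 + 28 * (real n)\<^sup>2 * \<delta> * M) * N\<^sup>2"
      by (simp add: power_mult_distrib algebra_simps)
    finally have "real n * D\<^sup>2 \<le> (M\<^sup>2 + 28 * (real n)\<^sup>2 * \<delta> * M) * N\<^sup>2" by simp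
    moreover have "norm (blinfun_apply ((e o\<^sub>L a) - a) h) = D"
      by (simp add: D_def v_def x_def d_def blinfun.diff_left norm_minus_commute)
    ultimately show ?thesis by (simp add: N_def)
  qed
  define K where "K = M\<^sup>2 / real n + 28 * real n * \<delta> * M"
  have K: "0 \<le> K" using \<delta>0 M by (simp add: K_def)
  have nK: "real n * K = M\<^sup>2 + 28 * (real n)\<^sup>2 * \<delta> * M"
    using \<open>0 < n\<close> by (simp add: K_def field_simps power2_eq_square)
  have "norm ((e o\<^sub>L a) - a) \<le> sqrt K"
  proof (rule norm_blinfun_bound)
    fix h
    have "real n * (norm (blinfun_apply ((e o\<^sub>L a) - a) h))\<^sup>2 \<le> real n * (K * (norm h)\<^sup>2)"
      using main[of h] unfolding nK[symmetric] by (simp only: mult.assoc)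
    then have "(norm (blinfun_apply ((e o\<^sub>L a) - a) h))\<^sup>2 \<le> K * (norm h)\<^sup>2"
      using \<open>0 < n\<close> by simp
    also have "\<dots> = (sqrt K * norm h)\<^sup>2" using K by (simp add: power_mult_distrib)
    finally show "norm (blinfun_apply ((e o\<^sub>L a) - a) h) \<le> sqrt K * norm h"
      by (rule power2_le_imp_le) (use K in simp)
  qed (use K in simp)
  then have "(norm ((e o\<^sub>L a) - a))\<^sup>2 \<le> (sqrt K)\<^sup>2" by (intro power_mono) auto
  then show ?thesis using K by (simp add: K_def)
qed

text \<open>
  A Jordan approximate identity only controls \<open>e a + a e\<close>. For contractions this already
  forces \<open>e a\<close> and \<open>a e\<close> to tend to \<open>a\<close> separately.
\<close>

lemma eventually_two_sided_unit:
  assumes cai: "jordan_cai E e F" and a: "a \<in> E" and "0 < \<epsilon>"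
  shows "\<forall>\<^sub>F t in F. norm ((e t o\<^sub>L a) - a) < \<epsilon> \<and> norm ((a o\<^sub>L e t) - a) < \<epsilon>"
proof -
  define M where "M = norm a + 1"
  have M: "0 < M" "norm a \<le> M" by (auto simp: M_def add_nonneg_pos)
  define \<eta> where "\<eta> = \<epsilon> / 2"
  have \<eta>: "0 < \<eta>" using \<open>0 < \<epsilon>\<close> by (simp add: \<eta>_def)
  obtain m :: nat where "M\<^sup>2 * 2 / \<eta>\<^sup>2 < real m" using reals_Archimedean2 by blast
  then have n: "0 < n" "M\<^sup>2 * 2 / \<eta>\<^sup>2 < real n" if "n = Suc m" for n
    using that by auto
  define n where "n = Suc m"
  note n = n[OF n_def]
  \<comment> \<open>First \<open>n\<close> makes the term \<open>M\<^sup>2 / n\<close> small, then \<open>\<delta>\<close> makes the accumulated error small;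
    the bound \<open>\<epsilon> / 4\<close> serves to pass from \<open>e a\<close> to \<open>a e\<close>.\<close>
  define \<delta> where "\<delta> = min (\<epsilon> / 4) (\<eta>\<^sup>2 / (112 * real n * M))"
  have \<delta>: "0 < \<delta>" "\<delta> \<le> \<epsilon> / 4" "\<delta> \<le> \<eta>\<^sup>2 / (112 * real n * M)"
    using n M \<eta> \<open>0 < \<epsilon>\<close> by (auto simp: \<delta>_def)
  have small: "M\<^sup>2 / real n + 28 * real n * \<delta> * M < \<eta>\<^sup>2"
  proof -
    have "M\<^sup>2 / real n < \<eta>\<^sup>2 / 2" using n \<eta> by (simp add: field_simps)
    moreover have "28 * real n * \<delta> * M \<le> 28 * real n * (\<eta>\<^sup>2 / (112 * real n * M)) * M"
      using \<delta>(3) n M by (intro mult_right_mono mult_left_mono) auto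
    moreover have "28 * real n * (\<eta>\<^sup>2 / (112 * real n * M)) * M = \<eta>\<^sup>2 / 4"
      using n M by (simp add: field_simps)
    ultimately show ?thesis using zero_less_power[OF \<eta>, of 2] by linarith
  qed
  have "((\<lambda>t. jordan_prod (e t) a) \<longlongrightarrow> a) F" using cai a by (auto simp: jordan_cai_def)
  then have "\<forall>\<^sub>F t in F. norm (jordan_prod (e t) a - a) < \<delta>"
    using \<delta>(1) unfolding dist_norm[symmetric] by (rule tendstoD)
  moreover have "\<forall>\<^sub>F t in F. norm (e t) \<le> 1"
    using cai unfolding jordan_cai_def by (auto elim: eventually_mono)
  ultimately show ?thesis
  proof eventually_elim
    case (elim t)
    have eq: "(e t o\<^sub>L a) + (a o\<^sub>L e t) - 2 *\<^sub>R a = 2 *\<^sub>R (jordan_prod (e t) a - a)"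
      by (simp add: jordan_prod_def algebra_simps)
    have d: "norm ((e t o\<^sub>L a) + (a o\<^sub>L e t) - 2 *\<^sub>R a) \<le> 2 * \<delta>"
      unfolding eq using elim(1) by simp
    have "(norm ((e t o\<^sub>L a) - a))\<^sup>2 < \<eta>\<^sup>2"
      using contraction_defect_bound[OF elim(2) M(2) d n(1)] small by linarith
    then have left: "norm ((e t o\<^sub>L a) - a) < \<eta>" using \<eta> by (simp add: power2_less_imp_less)
    have "(a o\<^sub>L e t) - a = ((e t o\<^sub>L a) + (a o\<^sub>L e t) - 2 *\<^sub>R a) - ((e t o\<^sub>L a) - a)"
      by (simp add: scaleR_2)
    then have "norm ((a o\<^sub>L e t) - a) \<le> 2 * \<delta> + norm ((e t o\<^sub>L a) - a)"
      using norm_triangle_ineq4[of "(e t o\<^sub>L a) + (a o\<^sub>L e t) - 2 *\<^sub>R a" "(e t o\<^sub>L a) - a"] d by simp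
    then show ?case using left \<delta>(2) \<open>0 < \<epsilon>\<close> by (auto simp: \<eta>_def)
  qed
qed

lemma finite_two_sided_unit:
  assumes "approximately_unital E" and B: "finite B" "B \<subseteq> E" and "0 < \<epsilon>"
  shows "\<exists>e\<in>E. norm e \<le> 1 \<and> (\<forall>b\<in>B. norm ((e o\<^sub>L b) - b) < \<epsilon> \<and> norm ((b o\<^sub>L e) - b) < \<epsilon>)"
proof -
  obtain e :: "('a \<Rightarrow>\<^sub>L 'a) \<Rightarrow> ('a \<Rightarrow>\<^sub>L 'a)" and F where cai: "jordan_cai E e F"
    using assms(1) unfolding approximately_unital_def by blast
  have "\<forall>\<^sub>F t in F. \<forall>b\<in>B. norm ((e t o\<^sub>L b) - b) < \<epsilon> \<and> norm ((b o\<^sub>L e t) - b) < \<epsilon>"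
    using B eventually_two_sided_unit[OF cai _ \<open>0 < \<epsilon>\<close>] by (intro eventually_ball_finite) auto
  moreover have "\<forall>\<^sub>F t in F. e t \<in> E \<and> norm (e t) \<le> 1" and "F \<noteq> bot"
    using cai by (auto simp: jordan_cai_def)
  ultimately show ?thesis
    using eventually_happens'[OF \<open>F \<noteq> bot\<close> eventually_conj] by blast
qed

section \<open>Accretive elements of an approximately unital algebra\<close>

text \<open>
  A contraction and its adjoint have the same fixed vectors; here approximately. Applied with
  either operator in the role of \<open>S\<close>.
\<close>

lemma formal_adjoint_defect_le:
  fixes y :: "'h::real_inner"
  assumes "inner (S y) y = inner (T y) y" and "norm (S y) \<le> norm y"
  shows "(norm (S y - y))\<^sup>2 \<le> 2 * norm y * norm (T y - y)"
proof -
  have "(norm (S y - y))\<^sup>2 = (norm (S y))\<^sup>2 - 2 * inner (T y) y + (norm y)\<^sup>2"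
    unfolding power2_norm_eq_inner assms(1)[symmetric]
    by (simp add: inner_diff_left inner_diff_right inner_commute)
  also have "(norm (S y))\<^sup>2 \<le> (norm y)\<^sup>2" using assms(2) by (intro power_mono) auto
  also have "(norm y)\<^sup>2 - 2 * inner (T y) y + (norm y)\<^sup>2 = 2 * inner (y - T y) y"
    by (simp add: inner_diff_left power2_norm_eq_inner)
  also have "\<dots> \<le> 2 * (norm (y - T y) * norm y)"
    by (intro mult_left_mono norm_cauchy_schwarz) simp
  finally show ?thesis by (simp add: norm_minus_commute mult_ac)
qed

text \<open>
  Since \<open>u\<close> is nearly a two-sided unit for \<open>x\<close>, and therefore so is \<open>u\<^sup>*\<close>, the operator \<open>x\<close> is nearly
  \<open>u\<^sup>* x u\<close>. A lower bound \<open>-\<epsilon>\<close> for its form thus improves to \<open>-\<epsilon> u\<^sup>* u\<close>, which is concentrated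
  where \<open>x\<close> lives.
\<close>

lemma inner_localize_lower_bound:
  fixes x u :: "'h::complex_hilbert_space \<Rightarrow>\<^sub>L 'h"
  assumes "u \<in> bounded_ops" and u1: "norm u \<le> 1"
    and lower: "\<And>h. - \<epsilon> * (norm h)\<^sup>2 \<le> inner (blinfun_apply x h) h"
    and ux: "norm ((u o\<^sub>L x) - x) \<le> \<delta>" and xu: "norm ((x o\<^sub>L u) - x) \<le> \<delta>"
  shows "- \<epsilon> * (norm (blinfun_apply u h))\<^sup>2 - (\<delta> + sqrt (2 * norm x * \<delta>)) * (norm h)\<^sup>2
    \<le> inner (blinfun_apply x h) h"
proof -
  let ?u = "blinfun_apply u h" and ?x = "blinfun_apply x h"
  have \<delta>: "0 \<le> \<delta>" by (rule order_trans[OF norm_ge_zero ux])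
  have u_le: "norm (blinfun_apply u v) \<le> norm v" for v
    using norm_blinfun[of u v] mult_right_mono[OF u1, of "norm v"] by simp
  have adj_le: "norm (blinfun_apply (adj u) v) \<le> norm v" for v
    using norm_adj_apply_le[OF \<open>u \<in> bounded_ops\<close>, of v] mult_right_mono[OF u1, of "norm v"] by simp
  have "norm (?x - blinfun_apply x ?u) \<le> \<delta> * norm h"
    using norm_blinfun[of "(x o\<^sub>L u) - x" h] mult_right_mono[OF xu, of "norm h"]
    by (simp add: blinfun.diff_left norm_minus_commute)
  then have "norm (?x - blinfun_apply x ?u) * norm ?u \<le> (\<delta> * norm h) * norm h"
    using u_le[of h] \<delta> by (intro mult_mono) auto
  then have 1: "- \<delta> * (norm h)\<^sup>2 \<le> inner (?x - blinfun_apply x ?u) ?u"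
    using Cauchy_Schwarz_ineq2[of "?x - blinfun_apply x ?u" ?u] by (simp add: power2_eq_square mult_ac)
  have "norm (blinfun_apply u ?x - ?x) \<le> \<delta> * norm h"
    using norm_blinfun[of "(u o\<^sub>L x) - x" h] mult_right_mono[OF ux, of "norm h"]
    by (simp add: blinfun.diff_left)
  moreover have "(norm (blinfun_apply (adj u) ?x - ?x))\<^sup>2 \<le> 2 * norm ?x * norm (blinfun_apply u ?x - ?x)"
    by (intro formal_adjoint_defect_le adj_le)
      (unfold inner_adj[OF \<open>u \<in> bounded_ops\<close>], rule inner_commute)
  moreover have "2 * norm ?x * norm (blinfun_apply u ?x - ?x) \<le> 2 * (norm x * norm h) * (\<delta> * norm h)"
    if "norm (blinfun_apply u ?x - ?x) \<le> \<delta> * norm h"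
    using norm_blinfun[of x h] that by (intro mult_mono) auto
  ultimately have "(norm (blinfun_apply (adj u) ?x - ?x))\<^sup>2 \<le> 2 * (norm x * norm h) * (\<delta> * norm h)"
    by linarith
  also have "\<dots> = (sqrt (2 * norm x * \<delta>) * norm h)\<^sup>2"
    using \<delta> by (simp add: power_mult_distrib power2_eq_square)
  finally have "norm (blinfun_apply (adj u) ?x - ?x) \<le> sqrt (2 * norm x * \<delta>) * norm h"
    by (rule power2_le_imp_le) (use \<delta> in simp)
  then have "norm (blinfun_apply (adj u) ?x - ?x) * norm h \<le> (sqrt (2 * norm x * \<delta>) * norm h) * norm h"
    by (intro mult_right_mono) auto
  then have 2: "- sqrt (2 * norm x * \<delta>) * (norm h)\<^sup>2 \<le> inner (?x - blinfun_apply (adj u) ?x) h"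
    using Cauchy_Schwarz_ineq2[of "?x - blinfun_apply (adj u) ?x" h]
    by (simp add: power2_eq_square norm_minus_commute mult_ac)
  have "inner (blinfun_apply (adj u) ?x) h = inner ?x ?u"
    by (simp add: inner_adj[OF \<open>u \<in> bounded_ops\<close>] inner_commute)
  then have "inner ?x h = inner (blinfun_apply x ?u) ?u + inner (?x - blinfun_apply x ?u) ?u
      + inner (?x - blinfun_apply (adj u) ?x) h"
    by (simp add: inner_diff_left)
  then show ?thesis
    using lower[of ?u] 1 2 by (simp add: distrib_right)
qed

text \<open>
  A contraction \<open>e\<close> with \<open>u e\<close> close to \<open>u\<close> nearly fixes the range of \<open>u\<^sup>*\<close>, together with its adjoint.
  Its real part is thus close to \<open>1\<close> on that range and at least \<open>-1\<close> elsewhere. Precisely, with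
  \<open>f = u\<^sup>* u\<close> and up to small errors, expanding \<open>(1 - f) (1 + Re e) (1 - f) \<ge> 0\<close> gives
  \<open>1 + Re e \<ge> 4 f - 2 f\<^sup>2 \<ge> 2 f\<close>.
\<close>

lemma inner_unit_lower_bound:
  fixes u e :: "'h::complex_hilbert_space \<Rightarrow>\<^sub>L 'h"
  assumes ops: "u \<in> bounded_ops" "e \<in> bounded_ops" and u1: "norm u \<le> 1" and e1: "norm e \<le> 1"
    and ue: "norm ((u o\<^sub>L e) - u) \<le> \<delta>"
  shows "2 * (norm (blinfun_apply u h))\<^sup>2 - (norm h)\<^sup>2 - (\<delta> + 2 * sqrt (2 * \<delta>)) * (norm h)\<^sup>2
    \<le> inner (blinfun_apply e h) h"
proof -
  have \<delta>: "0 \<le> \<delta>" by (rule order_trans[OF norm_ge_zero ue])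
  have u_le: "norm (blinfun_apply u v) \<le> norm v" for v
    using norm_blinfun[of u v] mult_right_mono[OF u1, of "norm v"] by simp
  have e_le: "norm (blinfun_apply e v) \<le> norm v" for v
    using norm_blinfun[of e v] mult_right_mono[OF e1, of "norm v"] by simp
  have adj_le: "norm (blinfun_apply (adj u) v) \<le> norm v" for v
    using norm_adj_apply_le[OF ops(1), of v] mult_right_mono[OF u1, of "norm v"] by simp
  let ?w = "blinfun_apply u h"
  let ?y = "blinfun_apply (adj u) ?w"
  let ?ey = "blinfun_apply e ?y" and ?e'y = "blinfun_apply (adj e) ?y"
  have y_le: "norm ?y \<le> norm ?w" "norm ?w \<le> norm h" by (rule adj_le, rule u_le)
  have "norm (blinfun_apply (adj e) (blinfun_apply (adj u) w) - blinfun_apply (adj u) w) \<le> norm ((u o\<^sub>L e) - u) * norm w" for w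
    by (rule norm_formal_adjoint_le)
      (simp add: blinfun.diff_left inner_diff_left inner_diff_right inner_adj[OF ops(1)] inner_adj[OF ops(2)])
  from this[of ?w] have e'y: "norm (?e'y - ?y) \<le> \<delta> * norm h"
    by (rule order_trans) (use ue y_le \<delta> in \<open>auto intro!: mult_mono\<close>)
  have "(norm (?ey - ?y))\<^sup>2 \<le> 2 * norm ?y * norm (?e'y - ?y)"
    by (intro formal_adjoint_defect_le e_le) (unfold inner_adj[OF ops(2)], rule inner_commute)
  also have "\<dots> \<le> 2 * norm h * (\<delta> * norm h)"
    using y_le e'y by (intro mult_mono) auto
  also have "\<dots> = (sqrt (2 * \<delta>) * norm h)\<^sup>2"
    using \<delta> by (simp add: power_mult_distrib power2_eq_square)
  finally have ey: "norm (?ey - ?y) \<le> sqrt (2 * \<delta>) * norm h"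
    by (rule power2_le_imp_le) (use \<delta> in simp)
  have bound: "\<bar>inner p q\<bar> \<le> c * (norm h)\<^sup>2"
    if "norm p \<le> c * norm h" "norm q \<le> norm h" "0 \<le> c" for p q :: 'h and c
  proof -
    have "\<bar>inner p q\<bar> \<le> norm p * norm q" by (rule Cauchy_Schwarz_ineq2)
    also have "\<dots> \<le> (c * norm h) * norm h" using that by (intro mult_mono) auto
    finally show ?thesis by (simp add: power2_eq_square mult_ac)
  qed
  have s: "0 \<le> sqrt (2 * \<delta>)" using \<delta> by simp
  have 1: "\<bar>inner (?ey - ?y) h\<bar> \<le> sqrt (2 * \<delta>) * (norm h)\<^sup>2" by (rule bound[OF ey order_refl s])
  have 2: "\<bar>inner (?ey - ?y) ?y\<bar> \<le> sqrt (2 * \<delta>) * (norm h)\<^sup>2"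
    by (rule bound[OF ey order_trans[OF y_le] s])
  have 3: "\<bar>inner (?e'y - ?y) h\<bar> \<le> \<delta> * (norm h)\<^sup>2" by (rule bound[OF e'y order_refl \<delta>])
  have yh: "inner ?y h = (norm ?w)\<^sup>2"
    using inner_adj[OF ops(1), of h ?w] by (simp add: inner_commute power2_norm_eq_inner)
  have yy: "(norm ?y)\<^sup>2 \<le> (norm ?w)\<^sup>2" using y_le(1) by (intro power_mono) auto
  let ?k = "h - ?y"
  have "- inner (blinfun_apply e ?k) ?k \<le> norm (blinfun_apply e ?k) * norm ?k"
    using Cauchy_Schwarz_ineq2[of "blinfun_apply e ?k" ?k] by linarith
  also have "\<dots> \<le> norm ?k * norm ?k" by (intro mult_right_mono e_le norm_ge_zero)
  finally have k: "0 \<le> (norm ?k)\<^sup>2 + inner (blinfun_apply e ?k) ?k"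
    by (simp add: power2_eq_square)
  have kk: "(norm ?k)\<^sup>2 = (norm h)\<^sup>2 - 2 * inner ?y h + (norm ?y)\<^sup>2"
    by (simp add: power2_norm_eq_inner inner_diff_left inner_diff_right inner_commute)
  have "inner (blinfun_apply e h) ?y = inner ?e'y h"
    by (simp add: inner_adj[OF ops(2)] inner_commute)
  then have ek: "inner (blinfun_apply e ?k) ?k = inner (blinfun_apply e h) h - inner ?ey h - inner ?e'y h + inner ?ey ?y"
    by (simp add: blinfun.diff_right inner_diff_left inner_diff_right)
  have "inner ?ey h = inner (?ey - ?y) h + inner ?y h" "inner ?e'y h = inner (?e'y - ?y) h + inner ?y h"
    "inner ?ey ?y = inner (?ey - ?y) ?y + (norm ?y)\<^sup>2"
    by (simp_all add: inner_diff_left power2_norm_eq_inner)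
  then show ?thesis
    using 1 2 3 k yy unfolding kk ek yh distrib_right by linarith
qed

context jordan_algebra
begin

text \<open>
  Half of the negative part can be cancelled by one further approximate unit. Choose \<open>u\<close> for \<open>x\<close> and
  then \<open>e\<close> for \<open>u\<close>; up to small errors the two preceding lemmas give
  \<open>Re x + (\<epsilon>/2) Re e \<ge> -\<epsilon> u\<^sup>* u + \<epsilon> u\<^sup>* u - \<epsilon>/2\<close>. The factor \<open>3/4\<close> leaves room for the errors.
\<close>

lemma improve_lower_bound:
  assumes au: "approximately_unital A" and x: "x \<in> A" and a: "a \<in> A" and "0 < \<epsilon>" "0 < \<eta>"
    and lower: "\<And>h. - \<epsilon> * (norm h)\<^sup>2 \<le> inner (blinfun_apply x h) h"
  shows "\<exists>e\<in>A. norm e \<le> 1 \<and> norm ((e o\<^sub>L a) - a) \<le> \<eta> \<and> norm ((a o\<^sub>L e) - a) \<le> \<eta> \<and>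
    (\<forall>h. - (3/4 * \<epsilon>) * (norm h)\<^sup>2 \<le> inner (blinfun_apply (x + (\<epsilon> / 2) *\<^sub>R e) h) h)"
proof -
  have "((\<lambda>\<delta>. \<delta> + sqrt (2 * norm x * \<delta>) + \<epsilon> / 2 * (\<delta> + 2 * sqrt (2 * \<delta>))) \<longlongrightarrow> 0) (at_right 0)"
    by (auto intro!: tendsto_eq_intros)
  then have "\<forall>\<^sub>F \<delta> in at_right 0. \<delta> + sqrt (2 * norm x * \<delta>) + \<epsilon> / 2 * (\<delta> + 2 * sqrt (2 * \<delta>)) < \<epsilon> / 4"
    by (rule order_tendstoD) (use \<open>0 < \<epsilon>\<close> in simp)
  then have "\<forall>\<^sub>F \<delta> in at_right 0. 0 < \<delta> \<and> \<delta> + sqrt (2 * norm x * \<delta>) + \<epsilon> / 2 * (\<delta> + 2 * sqrt (2 * \<delta>)) < \<epsilon> / 4"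
    by (intro eventually_conj eventually_at_right_less)
  then obtain \<delta> where \<delta>: "0 < \<delta>" "\<delta> + sqrt (2 * norm x * \<delta>) + \<epsilon> / 2 * (\<delta> + 2 * sqrt (2 * \<delta>)) < \<epsilon> / 4"
    using eventually_happens'[OF trivial_limit_at_right_real] by blast
  obtain u where u: "u \<in> A" "norm u \<le> 1" "norm ((u o\<^sub>L x) - x) < \<delta>" "norm ((x o\<^sub>L u) - x) < \<delta>"
    using finite_two_sided_unit[OF au, of "{x}" \<delta>] x \<delta>(1) by auto
  have "0 < min \<delta> \<eta>" using \<delta>(1) \<open>0 < \<eta>\<close> by simp
  then obtain e where e: "e \<in> A" "norm e \<le> 1" "norm ((u o\<^sub>L e) - u) < min \<delta> \<eta>"
    "norm ((e o\<^sub>L a) - a) < min \<delta> \<eta>" "norm ((a o\<^sub>L e) - a) < min \<delta> \<eta>"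
    using finite_two_sided_unit[OF au, of "{u, a}" "min \<delta> \<eta>"] u(1) a by blast
  have "- (3/4 * \<epsilon>) * (norm h)\<^sup>2 \<le> inner (blinfun_apply (x + (\<epsilon> / 2) *\<^sub>R e) h) h" for h
  proof -
    let ?n = "(norm h)\<^sup>2" and ?u = "(norm (blinfun_apply u h))\<^sup>2"
    have "- \<epsilon> * ?u - (\<delta> + sqrt (2 * norm x * \<delta>)) * ?n \<le> inner (blinfun_apply x h) h"
      using inner_localize_lower_bound[OF bounded_opsI[OF u(1)] u(2) lower] u(3,4) by auto
    moreover have "\<epsilon> / 2 * (2 * ?u - ?n - (\<delta> + 2 * sqrt (2 * \<delta>)) * ?n) \<le> \<epsilon> / 2 * inner (blinfun_apply e h) h"
      using inner_unit_lower_bound[OF bounded_opsI[OF u(1)] bounded_opsI[OF e(1)] u(2) e(2)] e(3) \<open>0 < \<epsilon>\<close>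
      by (intro mult_left_mono) auto
    moreover have "(\<delta> + sqrt (2 * norm x * \<delta>) + \<epsilon> / 2 * (\<delta> + 2 * sqrt (2 * \<delta>))) * ?n \<le> (\<epsilon> / 4) * ?n"
      using \<delta>(2) by (intro mult_right_mono) auto
    ultimately show ?thesis
      by (simp add: blinfun.bilinear_simps inner_add_left algebra_simps)
  qed
  then show ?thesis using e by (intro bexI[of _ e]) auto
qed

text \<open>
  Starting from \<open>0\<close>, whose form is trivially at least \<open>-1\<close>, the improvement step is iterated. The limit is
  accretive and has the shape \<open>\<Sum>n. w\<^sub>n e\<^sub>n\<close>, where all \<open>e\<^sub>n\<close> nearly fix \<open>a\<close> and the weights
  \<open>w\<^sub>n = (3/4)\<^sup>n / 2\<close> add up to \<open>2\<close>; half of it nearly fixes \<open>a\<close>.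
\<close>

lemma accretive_approximate_unit:
  assumes au: "approximately_unital A" and a: "a \<in> A" and "0 < \<eta>"
  shows "\<exists>x\<in>A. accretive x \<and> norm ((x o\<^sub>L a) - a) \<le> \<eta> \<and> norm ((a o\<^sub>L x) - a) \<le> \<eta>"
proof -
  define q :: "nat \<Rightarrow> real" where "q n = (3/4) ^ n" for n
  \<comment> \<open>the sum of the first \<open>n\<close> weights\<close>
  define C where "C n = 2 - 2 * q n" for n
  have q: "0 < q n" "q (Suc n) = 3/4 * q n" "C (Suc n) = C n + q n / 2" for n
    by (auto simp: q_def C_def)
  have "\<exists>f. \<forall>n. (f n \<in> A \<and> (\<forall>h. - q n * (norm h)\<^sup>2 \<le> inner (blinfun_apply (f n) h) h) \<and>
      norm ((f n o\<^sub>L a) - C n *\<^sub>R a) \<le> C n * \<eta> \<and> norm ((a o\<^sub>L f n) - C n *\<^sub>R a) \<le> C n * \<eta>) \<and>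
      norm (f (Suc n) - f n) \<le> q n / 2"
  proof (rule dependent_nat_choice)
    show "\<exists>x. x \<in> A \<and> (\<forall>h. - q 0 * (norm h)\<^sup>2 \<le> inner (blinfun_apply x h) h) \<and>
      norm ((x o\<^sub>L a) - C 0 *\<^sub>R a) \<le> C 0 * \<eta> \<and> norm ((a o\<^sub>L x) - C 0 *\<^sub>R a) \<le> C 0 * \<eta>"
      using zero_mem by (intro exI[of _ 0]) (simp add: q_def C_def)
    fix x n
    assume x: "x \<in> A \<and> (\<forall>h. - q n * (norm h)\<^sup>2 \<le> inner (blinfun_apply x h) h) \<and>
      norm ((x o\<^sub>L a) - C n *\<^sub>R a) \<le> C n * \<eta> \<and> norm ((a o\<^sub>L x) - C n *\<^sub>R a) \<le> C n * \<eta>"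
    obtain e where e: "e \<in> A" "norm e \<le> 1" "norm ((e o\<^sub>L a) - a) \<le> \<eta>" "norm ((a o\<^sub>L e) - a) \<le> \<eta>"
      "\<And>h. - (3/4 * q n) * (norm h)\<^sup>2 \<le> inner (blinfun_apply (x + (q n / 2) *\<^sub>R e) h) h"
      using improve_lower_bound[OF au _ a q(1) \<open>0 < \<eta>\<close>, of x n] x by blast
    let ?y = "x + (q n / 2) *\<^sub>R e"
    have "(?y o\<^sub>L a) - C (Suc n) *\<^sub>R a = ((x o\<^sub>L a) - C n *\<^sub>R a) + (q n / 2) *\<^sub>R ((e o\<^sub>L a) - a)"
      "(a o\<^sub>L ?y) - C (Suc n) *\<^sub>R a = ((a o\<^sub>L x) - C n *\<^sub>R a) + (q n / 2) *\<^sub>R ((a o\<^sub>L e) - a)"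
      by (simp_all add: q(3) compose_simps scaleR_diff_right scaleR_add_left)
    moreover have "norm (p + (q n / 2) *\<^sub>R r) \<le> C (Suc n) * \<eta>"
      if "norm p \<le> C n * \<eta>" "norm r \<le> \<eta>" for p r :: "'h \<Rightarrow>\<^sub>L 'h"
    proof -
      have "norm (p + (q n / 2) *\<^sub>R r) \<le> norm p + (q n / 2) * norm r"
        using norm_triangle_ineq[of p "(q n / 2) *\<^sub>R r"] q(1)[of n] by simp
      also have "\<dots> \<le> C n * \<eta> + (q n / 2) * \<eta>"
        using that q(1)[of n] by (intro add_mono mult_left_mono) auto
      finally show ?thesis by (simp add: q(3) distrib_right)
    qed
    ultimately have "norm ((?y o\<^sub>L a) - C (Suc n) *\<^sub>R a) \<le> C (Suc n) * \<eta>"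
      "norm ((a o\<^sub>L ?y) - C (Suc n) *\<^sub>R a) \<le> C (Suc n) * \<eta>"
      using x e(3,4) by simp_all
    moreover have "norm (?y - x) \<le> q n / 2"
      using q(1)[of n] e(2) by simp
    moreover have "?y \<in> A" using x e(1) by (auto intro: add_mem scaleR_mem)
    ultimately show "\<exists>y. (y \<in> A \<and> (\<forall>h. - q (Suc n) * (norm h)\<^sup>2 \<le> inner (blinfun_apply y h) h) \<and>
      norm ((y o\<^sub>L a) - C (Suc n) *\<^sub>R a) \<le> C (Suc n) * \<eta> \<and> norm ((a o\<^sub>L y) - C (Suc n) *\<^sub>R a) \<le> C (Suc n) * \<eta>) \<and>
      norm (y - x) \<le> q n / 2"
      using e(5) unfolding q(2) by blast
  qed
  then obtain f where f: "\<And>n. f n \<in> A"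
    "\<And>n h. - q n * (norm h)\<^sup>2 \<le> inner (blinfun_apply (f n) h) h"
    "\<And>n. norm ((f n o\<^sub>L a) - C n *\<^sub>R a) \<le> C n * \<eta>" "\<And>n. norm ((a o\<^sub>L f n) - C n *\<^sub>R a) \<le> C n * \<eta>"
    "\<And>n. norm (f (Suc n) - f n) \<le> q n / 2" by blast
  have q0: "q \<longlonglongrightarrow> 0" unfolding q_def by (rule LIMSEQ_power_zero) simp
  have C2: "C \<longlonglongrightarrow> 2" unfolding C_def by (auto intro!: tendsto_eq_intros q0)
  have "summable (\<lambda>n. f (Suc n) - f n)"
  proof (rule summable_comparison_test'[where N = 0])
    show "summable (\<lambda>n. q n / 2)" unfolding q_def by (intro summable_divide summable_geometric) simp
  qed (use f(5) in simp)
  then have "(\<lambda>n. \<Sum>k<n. f (Suc k) - f k) \<longlonglongrightarrow> (\<Sum>k. f (Suc k) - f k)" by (rule summable_LIMSEQ)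
  then have "(\<lambda>n. f n - f 0) \<longlonglongrightarrow> (\<Sum>k. f (Suc k) - f k)" by (simp only: sum_lessThan_telescope)
  from tendsto_add[OF this tendsto_const[of "f 0"]]
  obtain x where x: "f \<longlonglongrightarrow> x" by auto
  have xA: "x \<in> A" using closed_sequentially[OF closed_carrier _ x] f(1) by blast
  have acc: "accretive x"
    unfolding accretive_def
  proof
    fix h :: 'h
    have "(\<lambda>n. - q n * (norm h)\<^sup>2) \<longlonglongrightarrow> - 0 * (norm h)\<^sup>2" by (intro tendsto_intros q0)
    moreover have "(\<lambda>n. inner (blinfun_apply (f n) h) h) \<longlonglongrightarrow> inner (blinfun_apply x h) h"
      by (intro tendsto_intros x)
    ultimately show "0 \<le> inner (blinfun_apply x h) h"
      using LIMSEQ_le[of _ _ _ "inner (blinfun_apply x h) h"] f(2) by fastforce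
  qed
  have lim: "norm y \<le> 2 * \<eta>" if "g \<longlonglongrightarrow> y" "\<And>n. norm (g n) \<le> C n * \<eta>" for g and y :: "'h \<Rightarrow>\<^sub>L 'h"
    using that(2) by (intro LIMSEQ_le[OF tendsto_norm[OF that(1)] tendsto_mult_right[OF C2]]) auto
  have "norm ((x o\<^sub>L a) - 2 *\<^sub>R a) \<le> 2 * \<eta>"
    by (rule lim[OF _ f(3)])
      (intro tendsto_intros C2 x bounded_bilinear.tendsto[OF bounded_bilinear_blinfun_compose])
  moreover have "norm ((a o\<^sub>L x) - 2 *\<^sub>R a) \<le> 2 * \<eta>"
    by (rule lim[OF _ f(4)])
      (intro tendsto_intros C2 x bounded_bilinear.tendsto[OF bounded_bilinear_blinfun_compose])
  moreover have "(((1/2) *\<^sub>R x) o\<^sub>L a) - a = (1/2) *\<^sub>R ((x o\<^sub>L a) - 2 *\<^sub>R a)"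
    "(a o\<^sub>L ((1/2) *\<^sub>R x)) - a = (1/2) *\<^sub>R ((a o\<^sub>L x) - 2 *\<^sub>R a)"
    by (simp_all add: compose_simps scaleR_diff_right)
  ultimately have "norm ((((1/2) *\<^sub>R x) o\<^sub>L a) - a) \<le> \<eta>" "norm ((a o\<^sub>L ((1/2) *\<^sub>R x)) - a) \<le> \<eta>"
    by simp_all
  moreover have "accretive ((1/2) *\<^sub>R x)" using acc by (simp add: accretive_def blinfun.scaleR_left)
  ultimately show ?thesis using scaleR_mem[OF xA] by blast
qed

text \<open>
  The accretive element of \<open>E\<close> that nearly fixes \<open>a\<close> lies in the support part of \<open>A\<close>, so it is in turn
  nearly fixed by a firmly nonexpansive element of \<open>A\<close>.
\<close>

lemma approximately_unital_subset_support_part: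
  assumes E: "jordan_subalgebra E A" "approximately_unital E"
  shows "E \<subseteq> support_part"
proof
  fix a assume a: "a \<in> E"
  interpret E: jordan_algebra E using E(1) by unfold_locales (simp add: jordan_subalgebra_def)
  have EA: "E \<subseteq> A" using E(1) by (simp add: jordan_subalgebra_def)
  show "a \<in> support_part"
  proof (rule support_partI)
    show "a \<in> A" using a EA by blast
    fix \<epsilon> :: real assume "0 < \<epsilon>"
    then have "0 < \<epsilon> / 8" by simp
    then obtain x where x: "x \<in> E" "accretive x" "norm ((x o\<^sub>L a) - a) \<le> \<epsilon> / 8" "norm ((a o\<^sub>L x) - a) \<le> \<epsilon> / 8"
      using E.accretive_approximate_unit[OF E(2) a] by blast
    define M where "M = norm a + 1"
    have M: "0 < M" "norm a \<le> M" by (auto simp: M_def add_nonneg_pos)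
    have "0 < \<epsilon> / (2 * M)" using \<open>0 < \<epsilon>\<close> M by simp
    then obtain e where e: "e \<in> A" "firmly_nonexpansive e" "norm ((e o\<^sub>L x) - x) < \<epsilon> / (2 * M)" "norm ((x o\<^sub>L e) - x) < \<epsilon> / (2 * M)"
      using support_partE[OF accretive_in_support_part] x(1,2) EA by blast
    have e1: "norm e \<le> 1" by (rule firmly_nonexpansive_norm_le[OF e(2)])
    have *: "d * norm a \<le> \<epsilon> / 2" if "d < \<epsilon> / (2 * M)" "0 \<le> d" for d
    proof -
      have "d * norm a \<le> \<epsilon> / (2 * M) * M" using that M \<open>0 < \<epsilon>\<close> by (intro mult_mono) auto
      then show ?thesis using M by simp
    qed
    have "norm ((e o\<^sub>L a) - a) < \<epsilon>" "norm ((a o\<^sub>L e) - a) < \<epsilon>"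
      using norm_approx_left_le[OF e1, of a x] norm_approx_right_le[OF e1, of a x] x(3,4)
        *[OF e(3)] *[OF e(4)] \<open>0 < \<epsilon>\<close> by auto
    then show "\<exists>e\<in>A. firmly_nonexpansive e \<and> norm ((e o\<^sub>L a) - a) < \<epsilon> \<and> norm ((a o\<^sub>L e) - a) < \<epsilon>"
      using e(1,2) by blast
  qed
qed

end

section \<open>Real positive contractive maps\<close>

theorem proposition4p2:
  fixes A :: "('h::complex_hilbert_space \<Rightarrow>\<^sub>L 'h) set"
    and P :: "('h \<Rightarrow>\<^sub>L 'h) \<Rightarrow> ('h \<Rightarrow>\<^sub>L 'h)"
  assumes "jordan_operator_algebra A"
    and "linear_map_on A P"
    and "real_positive_map_on A P"
    and "contractive_on A P"
  shows "\<exists>D. largest_approximately_unital_subalgebra D A \<and>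
    hereditary_subalgebra D A \<and>
    P ` D \<subseteq> D \<and>
    linear_map_on D (restrict P D) \<and>
    real_positive_map_on D (restrict P D) \<and>
    contractive_on D (restrict P D) \<and>
    (projection_on A P \<longrightarrow> projection_on D (restrict P D)) \<and>
    (bicontractive_on A P \<longrightarrow> bicontractive_on D (restrict P D)) \<and>
    (symmetric_on A P \<longrightarrow> symmetric_on D (restrict P D))"
proof -
  interpret jordan_algebra A by unfold_locales fact
  let ?D = support_part
  have DA: "a \<in> A" if "a \<in> ?D" for a using that support_part_subset by blast
  have PD: "P a \<in> ?D" if "a \<in> ?D" for a
    using image_support_part_subset[OF assms(2-4)] that by blast
  have lin: "linear_map_on ?D (restrict P ?D)"
    using assms(2) DA PD support_part_add support_part_scaleC by (auto simp: linear_map_on_def)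
  show ?thesis
  proof (intro exI[of _ ?D] conjI impI)
    show "largest_approximately_unital_subalgebra ?D A"
      using jordan_subalgebra_support_part approximately_unital_support_part
        approximately_unital_subset_support_part
      by (simp add: largest_approximately_unital_subalgebra_def)
    show "hereditary_subalgebra ?D A" by (rule hereditary_subalgebra_support_part)
    show "P ` ?D \<subseteq> ?D" using PD by blast
    show "real_positive_map_on ?D (restrict P ?D)"
      using assms(3) DA by (simp add: real_positive_map_on_def)
    show "contractive_on ?D (restrict P ?D)"
      using assms(4) DA by (simp add: contractive_on_def)
    show "projection_on ?D (restrict P ?D)" if "projection_on A P"
      using that lin PD DA by (simp add: projection_on_def)
    show "bicontractive_on ?D (restrict P ?D)" if "bicontractive_on A P"
      using that DA by (simp add: bicontractive_on_def contractive_on_def)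
    show "symmetric_on ?D (restrict P ?D)" if "symmetric_on A P"
      using that DA by (simp add: symmetric_on_def contractive_on_def)
  qed (fact lin)
qed

end
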